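(* Let $n\geq 6$ and $k$ be integers, and let $T$ be a spanning tree of $K_n$ with exactly $k$ pendant vertices. Suppose that $\Sigma=(K_n,T^-)$ is unbalanced and that $\lambda_1(A(\Sigma))$ is maximum among all unbalanced signed complete graphs $(K_n,T'^-)$ where $T'$ ranges over spanning trees of $K_n$ with exactly $k$ pendant vertices. Then $T\cong T^*$, where $T^*$ is the tree on $n$ vertices obtained from the star $K_{1,k}$ by identifying one of its pendant vertices with an end vertex of a path $P_{n-k}$ on $n-k$ vertices (equivalently: $T^*$ has one vertex of degree $k$, exactly one of its neighbours has degree $2$ and starts a pendant path, and all other neighbours are pendant vertices).
   Context: A signed graph $\Sigma=(G,\sigma)$ consists of a simple graph $G=(V,E)$ and a sign function $\sigma:E\to\{-1,+1\}$. A cycle is negative if it contains an odd number of negative edges; $\Sigma$ is balanced if it has no negative cycle, and unbalanced otherwise. The adjacency matrix $A(\Sigma)=(a_{ij})$ has $a_{ij}=\sigma(v_iv_j)$ if $v_i\sim v_j$ and $a_{ij}=0$ otherwise; $\lambda_1(A(\Sigma))$ denotes its largest eigenvalue (the index of $\Sigma$). For a subgraph $H$ of the complete graph $K_n$, $(K_n,H^-)$ denotes the signed complete graph on $n$ vertices whose negative edges are exactly the edges of $H$ (all other edges positive). A pendant vertex is a vertex of degree one. *)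

theory Defs
  imports "Jordan_Normal_Form.Spectral_Radius"
begin

type_synonym 'a ugraph = "'a set \<times> 'a set set"

abbreviation verts :: "'a ugraph \<Rightarrow> 'a set" where "verts G \<equiv> fst G"
abbreviation edges :: "'a ugraph \<Rightarrow> 'a set set" where "edges G \<equiv> snd G"

definition simple_graph :: "'a ugraph \<Rightarrow> bool" where
  "simple_graph G \<longleftrightarrow> finite (verts G) \<and> (\<forall>e\<in>edges G. e \<subseteq> verts G \<and> card e = 2)"

definition complete_graph :: "nat \<Rightarrow> nat ugraph" where
  "complete_graph n = ({0..<n}, {e. e \<subseteq> {0..<n} \<and> card e = 2})"

definition vertex_degree :: "'a ugraph \<Rightarrow> 'a \<Rightarrow> nat" where
  "vertex_degree G v = card {e \<in> edges G. v \<in> e}"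

definition pendant_vertices :: "'a ugraph \<Rightarrow> 'a set" where
  "pendant_vertices G = {v \<in> verts G. vertex_degree G v = 1}"

definition walk :: "'a ugraph \<Rightarrow> 'a list \<Rightarrow> bool" where
  "walk G p \<longleftrightarrow> p \<noteq> [] \<and> set p \<subseteq> verts G \<and> successively (\<lambda>u v. {u, v} \<in> edges G) p"

definition connected_graph :: "'a ugraph \<Rightarrow> bool" where
  "connected_graph G \<longleftrightarrow> verts G \<noteq> {} \<and>
     (\<forall>u\<in>verts G. \<forall>v\<in>verts G. \<exists>p. walk G p \<and> hd p = u \<and> last p = v)"

text \<open>A cycle is given by the list of its vertices, the last one being joined to the first.\<close>

definition cycle :: "'a ugraph \<Rightarrow> 'a list \<Rightarrow> bool" where
  "cycle G c \<longleftrightarrow> length c \<ge> 3 \<and> distinct c \<and> walk G c \<and> {last c, hd c} \<in> edges G"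

definition cycle_edges :: "'a list \<Rightarrow> 'a set set" where
  "cycle_edges c = {{c ! i, c ! (Suc i mod length c)} | i. i < length c}"

definition tree :: "'a ugraph \<Rightarrow> bool" where
  "tree G \<longleftrightarrow> simple_graph G \<and> connected_graph G \<and> (\<nexists>c. cycle G c)"

definition spanning_tree :: "'a ugraph \<Rightarrow> 'a ugraph \<Rightarrow> bool" where
  "spanning_tree T G \<longleftrightarrow> tree T \<and> verts T = verts G \<and> edges T \<subseteq> edges G"

definition graph_iso :: "'a ugraph \<Rightarrow> 'b ugraph \<Rightarrow> bool" where
  "graph_iso G H \<longleftrightarrow> (\<exists>f. bij_betw f (verts G) (verts H) \<and>
     (\<forall>u\<in>verts G. \<forall>v\<in>verts G. {u, v} \<in> edges G \<longleftrightarrow> {f u, f v} \<in> edges H))"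

type_synonym 'a sgraph = "'a ugraph \<times> ('a set \<Rightarrow> int)"

definition signed_graph :: "'a sgraph \<Rightarrow> bool" where
  "signed_graph S \<longleftrightarrow> simple_graph (fst S) \<and> (\<forall>e\<in>edges (fst S). snd S e \<in> {-1, 1})"

definition negative_cycle :: "'a sgraph \<Rightarrow> 'a list \<Rightarrow> bool" where
  "negative_cycle S c \<longleftrightarrow> cycle (fst S) c \<and> odd (card {e \<in> cycle_edges c. snd S e = -1})"

definition balanced :: "'a sgraph \<Rightarrow> bool" where
  "balanced S \<longleftrightarrow> (\<nexists>c. negative_cycle S c)"

abbreviation unbalanced :: "'a sgraph \<Rightarrow> bool" where
  "unbalanced S \<equiv> \<not> balanced S"

text \<open>Meant for signed graphs with vertex set \<open>{0..<n}\<close>, the vertices being numbered from 0.\<close>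

definition adjacency_matrix :: "nat sgraph \<Rightarrow> real mat" where
  "adjacency_matrix S = (let n = card (verts (fst S)) in
     mat n n (\<lambda>(i, j). if {i, j} \<in> edges (fst S) then of_int (snd S {i, j}) else 0))"

definition largest_eigenvalue :: "real mat \<Rightarrow> real" where
  "largest_eigenvalue A = Max (spectrum A)"

definition signed_complete :: "nat \<Rightarrow> nat ugraph \<Rightarrow> nat sgraph" where
  "signed_complete n H = (complete_graph n, \<lambda>e. if e \<in> edges H then -1 else 1)"

lemma signed_graph_signed_complete: "signed_graph (signed_complete n H)"
  by (auto simp: signed_graph_def signed_complete_def simple_graph_def complete_graph_def)

definition star_graph :: "nat \<Rightarrow> nat ugraph" where
  "star_graph k = ({0..k}, {{0, i} | i. 1 \<le> i \<and> i \<le> k})"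

definition path_graph :: "nat \<Rightarrow> nat \<Rightarrow> nat ugraph" where
  "path_graph a b = ({a..<b}, {{i, Suc i} | i. a \<le> i \<and> Suc i < b})"

text \<open>
  The star \<open>K\<^bsub>1,k\<^esub>\<close> has centre \<open>0\<close> and pendant vertices \<open>1, \<dots>, k\<close>, and the path on \<open>n - k\<close> vertices is
  \<open>k, k + 1, \<dots>, n - 1\<close>. For \<open>1 \<le> k < n\<close> they share exactly the vertex \<open>k\<close>, so that their union is
  the graph obtained by identifying a pendant vertex of the star with an end vertex of the path.
\<close>

definition T_star :: "nat \<Rightarrow> nat \<Rightarrow> nat ugraph" where
  "T_star n k = (verts (star_graph k) \<union> verts (path_graph k n),
                 edges (star_graph k) \<union> edges (path_graph k n))"

end

theory Submission
  imports Defs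
begin

text \<open>
  Write \<open>L = \<lambda>\<^sub>1 + 1\<close> and let \<open>x\<close> be an eigenvector with \<open>S = \<Sum> x \<ge> 0\<close>, so that
  \<open>L x\<^sub>v = S - 2 \<Sum>\<^bsub>u ~ v\<^esub> x\<^sub>u\<close>. By the Rayleigh principle no rearrangement of \<open>T\<close> that keeps the number of
  leaves can decrease \<open>\<Sum>\<^bsub>u ~ v\<^esub> x\<^sub>u x\<^sub>v\<close>, and one that keeps it has the same eigenvector. Moving a branch
  at \<open>c\<close> from \<open>v\<close> to \<open>w\<close> therefore forces the sign of \<open>x\<^sub>c (x\<^sub>w - x\<^sub>v)\<close>. It follows that the values at
  branching vertices are strictly extremal among the internal vertices, so there are at most two
  branching vertices. If there are two, or if the only one has two long legs, then there are two hubs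
  of total degree \<open>k + 2\<close>, all others having degree at most 2, such that all but one of the neighbours of
  one hub are nonnegative and all but one of those of the other are nonpositive. Applying the eigenvalue
  equation twice gives an upper bound for \<open>L\<close> of order \<open>2 \<surd>k\<close>, which test vectors show to be below the
  value at \<open>T\<^sup>*\<close>. The only exceptions are two cases with \<open>n \<le> 7\<close>, where the signs give slightly more.
\<close>

section \<open>The Rayleigh principle\<close>

text \<open>Entries of both signs rule out a Perron vector, so every sign of \<open>x\<close> has to
  be won from exchanges of branches. Strictness comes from the equality case: there \<open>x\<close>
  solves the equations of both trees, and subtracting them at an affected vertex gives equalities
  between values. All trees with \<open>k\<close> leaves are competitors as soon as
  \<open>k + 2 <= n\<close>, because two internal vertices already make the signed graph unbalanced;
  with fewer, \<open>T\<close> is a star, and every cycle has 0 or 2 edges at its centre. The shift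
  by 1 comes from the matrix J - I - 2 A(T). For hubs of degrees \<open>d1\<close>,
  \<open>d2\<close> and sum S = 0 the two rounds give L^2 <= 4 (d1 + d2) = 4 (k + 2); for S > 0 the
  surplus is kept in check by a negative value, which forces S < 2 a. The obstacle is small orders:
  at n = 6, k = 3 the lower bound 21/5 stays below the square root of 20, and the tree in question
  is excluded by solving its equations; at n = 7, k = 3 only the correction for S fails, and a
  negative leaf improves S < 2 a to S <= a.\<close>

definition quad_form :: "nat \<Rightarrow> (nat \<Rightarrow> nat \<Rightarrow> real) \<Rightarrow> (nat \<Rightarrow> real) \<Rightarrow> real" where
  "quad_form n a y = (\<Sum>i<n. \<Sum>j<n. a i j * y i * y j)"

text \<open>Bolzano-Weierstrass one coordinate at a time: within the subsequence found for the
  earlier coordinates, a bounded monotone subsequence of the next one converges, and the earlier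
  limits survive.\<close>

lemma finite_convergent_subsequence:
  fixes X :: "nat \<Rightarrow> nat \<Rightarrow> real"
  assumes "\<And>m i. i < n \<Longrightarrow> \<bar>X m i\<bar> \<le> B"
  shows "\<exists>r. strict_mono r \<and> (\<forall>i<n. convergent (\<lambda>m. X (r m) i))"
  using assms
proof (induction n)
  case 0
  show ?case by (rule exI[of _ id]) (simp add: strict_mono_def)
next
  case (Suc n)
  then obtain r where r: "strict_mono r" "\<forall>i<n. convergent (\<lambda>m. X (r m) i)"
    by (meson less_SucI)
  obtain f where f: "strict_mono f" "monoseq (\<lambda>m. X (r (f m)) n)"
    using seq_monosub[of "\<lambda>m. X (r m) n"] by blast
  have "Bseq (\<lambda>m. X (r (f m)) n)"
    using Suc.prems[of n] by (intro BseqI'[of _ B]) simp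
  then have "convergent (\<lambda>m. X (r (f m)) n)"
    using f(2) Bseq_monoseq_convergent by blast
  moreover have "convergent (\<lambda>m. X (r (f m)) i)" if "i < n" for i
    using convergent_subseq_convergent[OF _ f(1), of "\<lambda>m. X (r m) i"] r(2) that
    by (simp add: o_def)
  ultimately show ?case
    using strict_mono_o[OF r(1) f(1)] by (intro exI[of _ "r \<circ> f"]) (auto simp: less_Suc_eq o_def)
qed

lemma quad_form_scale: "quad_form n a (\<lambda>i. c * y i) = c\<^sup>2 * quad_form n a y"
  unfolding quad_form_def sum_distrib_left
  by (intro sum.cong refl) (simp add: power2_eq_square mult_ac)

text \<open>A maximizing sequence on the unit sphere has a coordinatewise convergent subsequence,
  and form and norm are finite sums, hence continuous in the coordinates. Homogeneity carries the
  bound from the sphere to all \<open>y\<close>.\<close>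

lemma quad_form_maximizer:
  fixes a :: "nat \<Rightarrow> nat \<Rightarrow> real"
  assumes "0 < n"
  obtains x where "(\<Sum>i<n. (x i)\<^sup>2) = 1"
    "\<And>y. quad_form n a y \<le> quad_form n a x * (\<Sum>i<n. (y i)\<^sup>2)"
proof -
  define sph where "sph = {y :: nat \<Rightarrow> real. (\<Sum>i<n. (y i)\<^sup>2) = 1}"
  have le1: "\<bar>y i\<bar> \<le> 1" if "y \<in> sph" "i < n" for y i
  proof -
    have "(y i)\<^sup>2 \<le> (\<Sum>i<n. (y i)\<^sup>2)"
      using that(2) by (intro member_le_sum) auto
    then show ?thesis using that(1) by (simp add: sph_def abs_square_le_1)
  qed
  have "(\<lambda>i. if i = 0 then 1 else 0) \<in> sph"
    using assms by (simp add: sph_def if_distrib[of "\<lambda>t. t\<^sup>2"] cong: if_cong)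
  then have ne: "quad_form n a ` sph \<noteq> {}" by blast
  have bdd: "bdd_above (quad_form n a ` sph)"
  proof (rule bdd_aboveI2)
    fix y assume y: "y \<in> sph"
    have "a i j * y i * y j \<le> \<bar>a i j\<bar>" if "i < n" "j < n" for i j
    proof -
      have "\<bar>y i\<bar> * \<bar>y j\<bar> \<le> 1 * 1" by (rule mult_mono) (use le1[OF y] that in auto)
      then have "\<bar>a i j\<bar> * (\<bar>y i\<bar> * \<bar>y j\<bar>) \<le> \<bar>a i j\<bar>" by (simp add: mult_left_le)
      then show ?thesis by (metis abs_mult abs_ge_self mult.assoc order.trans)
    qed
    then show "quad_form n a y \<le> (\<Sum>i<n. \<Sum>j<n. \<bar>a i j\<bar>)"
      unfolding quad_form_def by (intro sum_mono) auto
  qed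
  define M where "M = Sup (quad_form n a ` sph)"
  have "\<exists>y\<in>sph. M - 1 / real (Suc m) < quad_form n a y" for m
  proof -
    have "M - 1 / real (Suc m) < M" by simp
    then show ?thesis unfolding M_def by (subst (asm) less_cSup_iff[OF ne bdd]) auto
  qed
  then obtain Y where Y: "\<And>m. Y m \<in> sph" "\<And>m. M - 1 / real (Suc m) < quad_form n a (Y m)"
    by metis
  obtain r where r: "strict_mono r" "\<forall>i<n. convergent (\<lambda>m. Y (r m) i)"
    using finite_convergent_subsequence[of n Y 1] le1[OF Y(1)] by blast
  define x where "x i = lim (\<lambda>m. Y (r m) i)" for i
  have lim: "(\<lambda>m. Y (r m) i) \<longlonglongrightarrow> x i" if "i < n" for i
    using r(2) that by (simp add: x_def convergent_LIMSEQ_iff)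
  have "(\<lambda>m. \<Sum>i<n. (Y (r m) i)\<^sup>2) \<longlonglongrightarrow> (\<Sum>i<n. (x i)\<^sup>2)"
    using lim by (intro tendsto_intros) auto
  then have x1: "(\<Sum>i<n. (x i)\<^sup>2) = 1"
    using Y(1) by (simp add: sph_def LIMSEQ_const_iff)
  have qlim: "(\<lambda>m. quad_form n a (Y (r m))) \<longlonglongrightarrow> quad_form n a x"
    unfolding quad_form_def using lim by (intro tendsto_intros) auto
  have "(\<lambda>m. M - 1 / real (Suc m)) \<longlonglongrightarrow> M - 0"
    by (intro tendsto_diff tendsto_const LIMSEQ_Suc lim_1_over_n)
  then have Mlim: "(\<lambda>m. M - 1 / real (Suc (r m))) \<longlonglongrightarrow> M"
    using LIMSEQ_subseq_LIMSEQ[OF _ r(1)] by (fastforce simp: o_def)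
  have Mx: "M \<le> quad_form n a x"
    by (rule LIMSEQ_le[OF Mlim qlim]) (use Y(2) less_imp_le in blast)
  have "quad_form n a y \<le> quad_form n a x * (\<Sum>i<n. (y i)\<^sup>2)" for y
  proof (cases "(\<Sum>i<n. (y i)\<^sup>2) = 0")
    case True
    then have "\<forall>i<n. y i = 0" by (simp add: sum_nonneg_eq_0_iff)
    then show ?thesis using True by (simp add: quad_form_def)
  next
    case False
    define s where "s = (\<Sum>i<n. (y i)\<^sup>2)"
    have s: "s > 0" using False by (simp add: s_def sum_nonneg less_le)
    have "(\<lambda>i. (1 / sqrt s) * y i) \<in> sph"
      using s by (simp add: sph_def power_divide sum_divide_distrib[symmetric] s_def[symmetric])
    then have "(1 / sqrt s)\<^sup>2 * quad_form n a y \<le> M"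
      unfolding M_def using bdd by (subst quad_form_scale[symmetric]) (rule cSUP_upper)
    then have "quad_form n a y \<le> M * s"
      using s by (simp add: power_divide field_simps)
    also have "\<dots> \<le> quad_form n a x * s" using Mx s by simp
    finally show ?thesis by (simp add: s_def)
  qed
  then show thesis using that x1 by blast
qed

text \<open>Near 0 a nonzero linear term beats a quadratic one;
  \<open>t = b / (\<bar>c\<bar> + 1)\<close> is close enough.\<close>

lemma linear_coeff_zero:
  fixes b c :: real
  assumes "\<And>t. b * t \<le> c * t\<^sup>2"
  shows "b = 0"
proof (rule ccontr)
  assume b: "b \<noteq> 0"
  define d where "d = \<bar>c\<bar> + 1"
  have "b * (b / d) \<le> c * (b / d)\<^sup>2" by (rule assms)
  also have "\<dots> \<le> \<bar>c\<bar> * (b / d)\<^sup>2" by (simp add: mult_right_mono)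
  also have "\<dots> < d * (b / d)\<^sup>2" using b by (intro mult_strict_right_mono) (auto simp: d_def)
  also have "\<dots> = b * (b / d)" by (simp add: power2_eq_square d_def)
  finally show False by simp
qed

text \<open>First variation: along \<open>x + t * e\<close>, with \<open>e\<close> the unit vector
  at \<open>i\<close>, the first-order term is twice the residual of the equation and must vanish.
  Any upper bound \<open>\<mu>\<close> of the form that \<open>x\<close> attains will do, so that
  one vector can be tested against the matrices of different trees.\<close>

lemma rayleigh_equality:
  fixes a :: "nat \<Rightarrow> nat \<Rightarrow> real"
  assumes sym: "\<And>i j. a i j = a j i"
    and le: "\<And>y. quad_form n a y \<le> \<mu> * (\<Sum>i<n. (y i)\<^sup>2)"
    and eq: "quad_form n a x = \<mu> * (\<Sum>i<n. (x i)\<^sup>2)"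
    and i: "i < n"
  shows "(\<Sum>j<n. a i j * x j) = \<mu> * x i"
proof -
  define e where "e j = (if j = i then 1 else 0 :: real)" for j
  have e2: "e u * e u = e u" for u by (simp add: e_def)
  have d: "(\<Sum>u<n. f u * e u) = f i" for f
    using i by (simp add: e_def if_distrib sum.delta cong: if_cong)
  have "2 * ((\<Sum>j<n. a i j * x j) - \<mu> * x i) * t \<le> (\<mu> - a i i) * t\<^sup>2" for t
  proof -
    define y where "y j = x j + t * e j" for j
    have "quad_form n a y = quad_form n a x + t * (\<Sum>u<n. \<Sum>v<n. a u v * x u * e v)
        + t * (\<Sum>u<n. \<Sum>v<n. a u v * x v * e u) + t\<^sup>2 * (\<Sum>u<n. \<Sum>v<n. a u v * e u * e v)"
      unfolding quad_form_def y_def sum_distrib_left sum.distrib[symmetric]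
      by (intro sum.cong refl) (simp add: power2_eq_square algebra_simps)
    moreover have "(\<Sum>u<n. \<Sum>v<n. a u v * x u * e v) = (\<Sum>j<n. a i j * x j)"
      by (simp add: d sym[of _ i])
    moreover have "(\<Sum>u<n. \<Sum>v<n. a u v * x v * e u) = (\<Sum>j<n. a i j * x j)"
      by (simp add: sum_distrib_right[symmetric] d)
    moreover have "(\<Sum>u<n. \<Sum>v<n. a u v * e u * e v) = a i i"
      by (simp add: d)
    moreover have "(\<Sum>j<n. (y j)\<^sup>2) = (\<Sum>j<n. (x j)\<^sup>2) + 2 * t * (\<Sum>j<n. x j * e j) + t\<^sup>2 * (\<Sum>j<n. 1 * e j)"
      unfolding y_def sum_distrib_left sum.distrib[symmetric]
      by (intro sum.cong refl) (auto simp: power2_eq_square algebra_simps e2 e_def)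
    ultimately show ?thesis
      using le[of y] eq by (simp only: d) (simp add: algebra_simps)
  qed
  from linear_coeff_zero[OF this] show ?thesis by simp
qed

lemma mat_eigenvalue_iff:
  fixes a :: "nat \<Rightarrow> nat \<Rightarrow> real"
  shows "eigenvalue (mat n n (\<lambda>(i, j). a i j)) \<mu> \<longleftrightarrow>
    (\<exists>x. (\<exists>i<n. x i \<noteq> 0) \<and> (\<forall>i<n. (\<Sum>j<n. a i j * x j) = \<mu> * x i))"
    (is "eigenvalue ?A \<mu> \<longleftrightarrow> ?R")
proof
  assume "eigenvalue ?A \<mu>"
  then obtain v where v: "v \<in> carrier_vec n" "v \<noteq> 0\<^sub>v n" "?A *\<^sub>v v = \<mu> \<cdot>\<^sub>v v"
    by (auto simp: eigenvalue_def eigenvector_def)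
  have "(\<Sum>j<n. a i j * v $ j) = \<mu> * v $ i" if "i < n" for i
  proof -
    have "(?A *\<^sub>v v) $ i = \<mu> * v $ i" using v that by simp
    then show ?thesis using v(1) that
      by (simp add: scalar_prod_def lessThan_atLeast0)
  qed
  moreover have "\<exists>i<n. v $ i \<noteq> 0" using v(1,2) by (metis carrier_vecD eq_vecI index_zero_vec)
  ultimately show ?R by (intro exI[of _ "\<lambda>i. v $ i"]) auto
next
  assume ?R
  then obtain x where x: "\<exists>i<n. x i \<noteq> 0" "\<forall>i<n. (\<Sum>j<n. a i j * x j) = \<mu> * x i" by blast
  have "?A *\<^sub>v vec n x = \<mu> \<cdot>\<^sub>v vec n x"
    using x(2) by (intro eq_vecI) (auto simp: scalar_prod_def lessThan_atLeast0)
  moreover have "vec n x \<noteq> 0\<^sub>v n" using x(1) by (metis index_vec index_zero_vec(1))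
  ultimately show "eigenvalue ?A \<mu>"
    by (auto simp: eigenvalue_def eigenvector_def intro!: exI[of _ "vec n x"])
qed

text \<open>The maximum of the form on the sphere is an eigenvalue by the equality case, and every
  eigenvalue is a Rayleigh quotient, hence at most that maximum. Finiteness of the spectrum makes
  \<open>Max\<close> meaningful.\<close>

lemma largest_eigenvalue_rayleigh:
  fixes a :: "nat \<Rightarrow> nat \<Rightarrow> real"
  assumes n: "0 < n" and sym: "\<And>i j. a i j = a j i"
  defines "\<mu> \<equiv> largest_eigenvalue (mat n n (\<lambda>(i, j). a i j))"
  shows "quad_form n a y \<le> \<mu> * (\<Sum>i<n. (y i)\<^sup>2)"
    and "\<exists>x. (\<exists>i<n. x i \<noteq> 0) \<and> (\<forall>i<n. (\<Sum>j<n. a i j * x j) = \<mu> * x i)"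
proof -
  let ?A = "mat n n (\<lambda>(i, j). a i j)"
  obtain x where x: "(\<Sum>i<n. (x i)\<^sup>2) = 1"
    "\<And>y. quad_form n a y \<le> quad_form n a x * (\<Sum>i<n. (y i)\<^sup>2)"
    using quad_form_maximizer[OF n] by blast
  define m where "m = quad_form n a x"
  have ev: "(\<Sum>j<n. a i j * x j) = m * x i" if "i < n" for i
    by (rule rayleigh_equality[OF sym _ _ that]) (use x in \<open>auto simp: m_def\<close>)
  have "\<exists>i<n. x i \<noteq> 0"
  proof (rule ccontr)
    assume "\<not> ?thesis"
    then have "(\<Sum>i<n. (x i)\<^sup>2) = 0" by simp
    with x(1) show False by simp
  qed
  with ev have em: "eigenvalue ?A m" unfolding mat_eigenvalue_iff by blast
  have max: "l \<le> m" if l: "eigenvalue ?A l" for l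
  proof -
    obtain z where z: "\<exists>i<n. z i \<noteq> 0" "\<forall>i<n. (\<Sum>j<n. a i j * z j) = l * z i"
      using l unfolding mat_eigenvalue_iff by blast
    have "quad_form n a z = (\<Sum>i<n. z i * (\<Sum>j<n. a i j * z j))"
      unfolding quad_form_def sum_distrib_left by (intro sum.cong refl) (simp add: mult_ac)
    also have "\<dots> = l * (\<Sum>i<n. (z i)\<^sup>2)"
      using z(2) by (simp add: sum_distrib_left power2_eq_square mult_ac)
    finally have "l * (\<Sum>i<n. (z i)\<^sup>2) \<le> m * (\<Sum>i<n. (z i)\<^sup>2)" using x(2)[of z] by (simp add: m_def)
    moreover have "(\<Sum>i<n. (z i)\<^sup>2) > 0"
    proof -
      obtain i where i: "i < n" "z i \<noteq> 0" using z(1) by blast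
      then show ?thesis by (intro sum_pos2[of _ i]) auto
    qed
    ultimately show ?thesis by simp
  qed
  have A: "?A \<in> carrier_mat n n" by simp
  have "\<mu> = m"
    unfolding \<mu>_def largest_eigenvalue_def spectrum_def
    using em max card_finite_spectrum(1)[OF A] by (intro Max_eqI) (auto simp: spectrum_def)
  then show "quad_form n a y \<le> \<mu> * (\<Sum>i<n. (y i)\<^sup>2)"
    "\<exists>x. (\<exists>i<n. x i \<noteq> 0) \<and> (\<forall>i<n. (\<Sum>j<n. a i j * x j) = \<mu> * x i)"
    using x(2) em by (auto simp: m_def mat_eigenvalue_iff)
qed

section \<open>Trees as symmetric relations\<close>

definition rdist :: "('a \<times> 'a) set \<Rightarrow> 'a \<Rightarrow> 'a \<Rightarrow> nat" where
  "rdist E r v = (LEAST m. (r, v) \<in> E ^^ m)"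

lemma relpow_rdist: "(r, v) \<in> E\<^sup>* \<Longrightarrow> (r, v) \<in> E ^^ rdist E r v"
  unfolding rdist_def rtrancl_power by (rule LeastI_ex)

lemma rdist_le: "(r, v) \<in> E ^^ m \<Longrightarrow> rdist E r v \<le> m"
  unfolding rdist_def by (rule Least_le)

lemma rdist_edge:
  assumes "(r, u) \<in> E\<^sup>*" "(u, v) \<in> E"
  shows "rdist E r v \<le> Suc (rdist E r u)"
  using relpow_rdist[OF assms(1)] assms(2) by (intro rdist_le) auto

lemma rdist_parent:
  assumes "(r, v) \<in> E\<^sup>*" "v \<noteq> r"
  obtains u where "(u, v) \<in> E" "(r, u) \<in> E\<^sup>*" "rdist E r v = Suc (rdist E r u)"
proof -
  have p: "(r, v) \<in> E ^^ rdist E r v" by (rule relpow_rdist[OF assms(1)])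
  with assms(2) obtain m where m: "rdist E r v = Suc m" by (cases "rdist E r v") auto
  with p obtain u where u: "(r, u) \<in> E ^^ m" "(u, v) \<in> E" by auto
  have r: "(r, u) \<in> E\<^sup>*" using u(1) by (rule relpow_imp_rtrancl)
  have "rdist E r u = m" using rdist_le[OF u(1)] rdist_edge[OF r u(2)] m by simp
  then show thesis using that u(2) r m by simp
qed

text \<open>Joining every vertex other than \<open>r\<close> to a neighbour closer to
  \<open>r\<close> gives a breadth-first tree, counted in ordered pairs. It serves twice: as a lower
  bound for the size of a connected relation in \<open>bridge\<close>, and as the spanning part of
  an acyclic graph in \<open>rel_tree_adj\<close>.\<close>

lemma connected_spanning_subrelation:
  assumes V: "finite V" "r \<in> V" and E: "E \<subseteq> V \<times> V" and conn: "\<And>v. v \<in> V \<Longrightarrow> (r, v) \<in> E\<^sup>*"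
    and sym: "sym E"
  obtains P where "P \<subseteq> E" "sym P" "\<And>u v. u \<in> V \<Longrightarrow> v \<in> V \<Longrightarrow> (u, v) \<in> P\<^sup>*"
    "card P + 2 = 2 * card V"
proof -
  let ?d = "rdist E r"
  have "\<exists>u. (u, v) \<in> E \<and> ?d u < ?d v" if "v \<in> V - {r}" for v
  proof -
    have "(r, v) \<in> E\<^sup>*" "v \<noteq> r" using conn that by auto
    from rdist_parent[OF this] show ?thesis by (metis lessI)
  qed
  then obtain p where p: "\<And>v. v \<in> V - {r} \<Longrightarrow> (p v, v) \<in> E \<and> ?d (p v) < ?d v" by metis
  define A where "A = (\<lambda>v. (p v, v)) ` (V - {r})"
  define B where "B = (\<lambda>v. (v, p v)) ` (V - {r})"
  have AB: "A \<inter> B = {}" 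
  proof -
    have False if "t \<in> A" "t \<in> B" for t
    proof -
      from that obtain v u where "t = (p v, v)" "v \<in> V - {r}" "t = (u, p u)" "u \<in> V - {r}"
        unfolding A_def B_def by (elim imageE)
      then show False using p[of u] p[of v] by (metis less_asym prod.inject)
    qed
    then show ?thesis by auto
  qed
  have cA: "card A = card (V - {r})" unfolding A_def by (rule card_image) (auto simp: inj_on_def)
  have cB: "card B = card (V - {r})" unfolding B_def by (rule card_image) (auto simp: inj_on_def)
  have fin: "finite A" "finite B" using V by (auto simp: A_def B_def)
  have "card (A \<union> B) + 2 = 2 * card V"
  proof -
    have "card V > 0" using V by (auto simp: card_gt_0_iff)
    then show ?thesis
      using V cA cB by (simp add: card_Un_disjoint[OF fin AB])
  qed
  moreover have sub: "A \<union> B \<subseteq> E" using p sym by (auto simp: A_def B_def dest: symD)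
  moreover have s: "sym (A \<union> B)" by (auto simp: A_def B_def sym_def)
  moreover have root: "(r, v) \<in> (A \<union> B)\<^sup>*" if "v \<in> V" for v
    using that
  proof (induction "?d v" arbitrary: v rule: less_induct)
    case less
    show ?case
    proof (cases "v = r")
      case False
      with less.prems p[of v] E have "p v \<in> V" "?d (p v) < ?d v" by auto
      with less.hyps have "(r, p v) \<in> (A \<union> B)\<^sup>*" by blast
      moreover have "(p v, v) \<in> A \<union> B" using False less.prems by (auto simp: A_def)
      ultimately show ?thesis by (rule rtrancl_into_rtrancl)
    qed simp
  qed
  moreover have "(u, v) \<in> (A \<union> B)\<^sup>*" if "u \<in> V" "v \<in> V" for u v
    using rtrancl_trans[of u r] root[OF that(2)] symD[OF sym_rtrancl[OF s] root[OF that(1)]] by blast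
  ultimately show thesis using that by blast
qed

definition leaf_set :: "'a set \<Rightarrow> ('a \<times> 'a) set \<Rightarrow> 'a set" where
  "leaf_set V E = {v \<in> V. card (E `` {v}) = 1}"

text \<open>The component of \<open>c\<close> after deletion of \<open>v\<close>; for an edge
  between \<open>v\<close> and \<open>c\<close> this is the branch at \<open>v\<close> through
  \<open>c\<close>.\<close>

definition side :: "('a \<times> 'a) set \<Rightarrow> 'a \<Rightarrow> 'a \<Rightarrow> 'a set" where
  "side E v c = {u. (c, u) \<in> {(a, b) \<in> E. a \<noteq> v \<and> b \<noteq> v}\<^sup>*}"

definition move :: "('a \<times> 'a) set \<Rightarrow> 'a \<Rightarrow> 'a \<Rightarrow> 'a \<Rightarrow> ('a \<times> 'a) set" where
  "move E v c w = E - {(v, c), (c, v)} \<union> {(w, c), (c, w)}"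

text \<open>Connectedness and the number of edges, each in both orientations, replace the absence of
  cycles: this form is checked after an exchange of edges by counting, and degrees are cardinalities
  of images.\<close>

locale rel_tree =
  fixes V :: "'a set" and E :: "('a \<times> 'a) set"
  assumes finite_V: "finite V" and V_ne: "V \<noteq> {}" and E_sub: "E \<subseteq> V \<times> V"
    and sym_E: "sym E" and irrefl_E: "irrefl E"
    and conn: "\<And>u v. u \<in> V \<Longrightarrow> v \<in> V \<Longrightarrow> (u, v) \<in> E\<^sup>*"
    and card_E: "card E + 2 = 2 * card V"
begin

lemma finite_E: "finite E"
  using finite_subset[OF E_sub] finite_V by simp

lemma edge_sym: "(a, b) \<in> E \<Longrightarrow> (b, a) \<in> E"
  using sym_E by (rule symD)

lemma edge_neq: "(a, b) \<in> E \<Longrightarrow> a \<noteq> b"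
  using irrefl_E by (auto simp: irrefl_def)

lemma edge_V: "(a, b) \<in> E \<Longrightarrow> a \<in> V" "(a, b) \<in> E \<Longrightarrow> b \<in> V"
  using E_sub by auto

lemma finite_nbrs: "finite (E `` {v})"
  using finite_subset[of "E `` {v}" V] finite_V E_sub by auto

text \<open>If \<open>a\<close> and \<open>b\<close> stayed connected without their edge, the
  remaining pairs would still connect all of \<open>V\<close> and number at least
  \<open>2 * card V - 2\<close>, which is more than are left.\<close>

lemma bridge:
  assumes "(a, b) \<in> E"
  shows "(a, b) \<notin> (E - {(a, b), (b, a)})\<^sup>*"
proof
  let ?F = "E - {(a, b), (b, a)}"
  assume ab: "(a, b) \<in> ?F\<^sup>*"
  have symF: "sym ?F" using sym_E by (auto simp: sym_def)
  have "(b, a) \<in> ?F\<^sup>*" using ab sym_rtrancl[OF symF] by (auto dest: symD)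
  with ab have "E \<subseteq> ?F\<^sup>*" by auto
  then have "E\<^sup>* \<subseteq> ?F\<^sup>*" by (metis rtrancl_subset_rtrancl)
  then have c: "(a, v) \<in> ?F\<^sup>*" if "v \<in> V" for v
    using conn[of a v] that edge_V[OF assms] by auto
  have FV: "?F \<subseteq> V \<times> V" using E_sub by auto
  obtain P where P: "P \<subseteq> ?F" "card P + 2 = 2 * card V"
    using connected_spanning_subrelation[OF finite_V edge_V(1)[OF assms] FV c symF] by metis
  have "card P \<le> card ?F" using P(1) finite_E by (intro card_mono) auto
  also have "\<dots> < card E" using assms finite_E by (intro psubset_card_mono) auto
  finally show False using P(2) card_E by simp
qed

lemma in_side_self: "c \<in> side E v c"
  by (simp add: side_def)

lemma side_closed: "a \<in> side E v c \<Longrightarrow> (a, b) \<in> E \<Longrightarrow> a \<noteq> v \<Longrightarrow> b \<noteq> v \<Longrightarrow> b \<in> side E v c"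
  unfolding side_def by (auto intro: rtrancl_into_rtrancl)

lemma side_neq: "u \<in> side E v c \<Longrightarrow> c \<noteq> v \<Longrightarrow> u \<noteq> v"
  unfolding side_def by (auto elim: rtranclE)

lemma side_V:
  assumes "u \<in> side E v c" "c \<in> V"
  shows "u \<in> V"
  using assms unfolding side_def mem_Collect_eq by (induction rule: rtrancl_induct) (auto dest: edge_V)

lemma side_sym: "u \<in> side E v c \<Longrightarrow> c \<in> side E v u"
proof -
  have "sym {(a, b) \<in> E. a \<noteq> v \<and> b \<noteq> v}" using sym_E by (auto simp: sym_def)
  from sym_rtrancl[OF this] show "u \<in> side E v c \<Longrightarrow> c \<in> side E v u"
    unfolding side_def by (auto dest: symD)
qed

lemma side_trans: "u \<in> side E v c \<Longrightarrow> d \<in> side E v u \<Longrightarrow> d \<in> side E v c"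
  unfolding side_def by auto

text \<open>Otherwise the step to \<open>c\<close> and a route inside the branch lead from
  \<open>v\<close> to \<open>d\<close> without the edge between them, which is a bridge.\<close>

lemma nbr_in_side:
  assumes "(v, c) \<in> E" "(v, d) \<in> E" "d \<in> side E v c"
  shows "d = c"
proof (rule ccontr)
  assume ne: "d \<noteq> c"
  let ?F = "E - {(v, d), (d, v)}"
  have "(v, c) \<in> ?F" using assms(1) ne edge_neq[OF assms(2)] by auto
  moreover have "(c, d) \<in> ?F\<^sup>*"
    using assms(3) unfolding side_def mem_Collect_eq by (rule rtrancl_mono[THEN subsetD, rotated]) auto
  ultimately have "(v, d) \<in> ?F\<^sup>*" by (rule converse_rtrancl_into_rtrancl)
  with bridge[OF assms(2)] show False by simp
qed

lemma side_unique:
  assumes "(v, c) \<in> E" "(v, d) \<in> E" "u \<in> side E v c" "u \<in> side E v d"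
  shows "d = c"
  using nbr_in_side[OF assms(1,2)] side_trans[OF assms(3) side_sym[OF assms(4)]] by simp

lemma side_cover:
  assumes "u \<in> V" "v \<in> V" "u \<noteq> v"
  obtains c where "(v, c) \<in> E" "u \<in> side E v c"
proof -
  have "(v, u) \<in> E\<^sup>*" using conn assms by auto
  then have "u = v \<or> (\<exists>c. (v, c) \<in> E \<and> u \<in> side E v c)"
  proof (induction rule: rtrancl_induct)
    case (step y z)
    show ?case
    proof (cases "z = v \<or> y = v")
      case True
      then show ?thesis using step.hyps(2) in_side_self by auto
    next
      case False
      then show ?thesis using step side_closed by blast
    qed
  qed simp
  with assms that show thesis by blast
qed

lemma leaf_side: "(v, c) \<in> E \<Longrightarrow> card (E `` {c}) = 1 \<Longrightarrow> side E v c = {c}"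
proof -
  assume e: "(v, c) \<in> E" and "card (E `` {c}) = 1"
  then have N: "E `` {c} = {v}" using edge_sym[OF e] by (metis Image_singleton_iff card_1_singletonE singletonD)
  have "u = c" if "u \<in> side E v c" for u
    using that unfolding side_def mem_Collect_eq by (cases rule: converse_rtranclE) (use N in auto)
  then show ?thesis using in_side_self by auto
qed

text \<open>Stepping away from \<open>v\<close> loses at least \<open>c\<close>; the size of the
  branch is the measure by which \<open>side_has_leaf\<close> finds a leaf.\<close>

lemma side_psubset:
  assumes "(v, c) \<in> E" "(c, d) \<in> E" "d \<noteq> v"
  shows "side E c d \<subset> side E v c"
proof -
  have vc: "v \<notin> side E c d"
    using nbr_in_side[OF assms(2) edge_sym[OF assms(1)]] assms(3) by auto
  have "side E c d \<subseteq> side E v c"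
  proof
    fix u assume "u \<in> side E c d"
    then have "(d, u) \<in> {(a, b) \<in> E. a \<noteq> c \<and> b \<noteq> c}\<^sup>*" by (simp add: side_def)
    then show "u \<in> side E v c"
    proof (induction rule: rtrancl_induct)
      case base
      show ?case using assms edge_neq[OF assms(1)] by (intro side_closed[OF in_side_self assms(2)]) auto
    next
      case (step y z)
      have "z \<in> side E c d" "y \<in> side E c d"
        using step.hyps by (auto simp: side_def intro: rtrancl_into_rtrancl)
      then have "z \<noteq> v" "y \<noteq> v" using vc by auto
      then show ?case using step side_closed by blast
    qed
  qed
  moreover have "c \<notin> side E c d" using side_neq[of c c d] edge_neq[OF assms(2)] by auto
  ultimately show ?thesis using in_side_self by blast
qed

lemma nbrs_ne:
  assumes "v \<in> V" "u \<in> V" "u \<noteq> v"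
  shows "card (E `` {v}) \<ge> 1"
  using side_cover[OF assms(2,1,3)] finite_nbrs[of v]
  by (metis Image_singleton_iff One_nat_def Suc_leI card_gt_0_iff empty_iff)

text \<open>Two adjacent leaves would be a whole component and leave no room for the third vertex
  \<open>v\<close>.\<close>

lemma leaf_nbr_internal:
  assumes l: "(l, m) \<in> E" "card (E `` {l}) = 1" and v: "v \<in> V" "v \<noteq> l" "v \<noteq> m"
  shows "card (E `` {m}) \<ge> 2"
proof (rule ccontr)
  assume a: "\<not> ?thesis"
  have "card (E `` {m}) = 1" using nbrs_ne[of m l] edge_V[OF l(1)] edge_neq[OF l(1)] a by auto
  then have s: "side E l m = {m}" using leaf_side l(1) by blast
  obtain d where d: "(l, d) \<in> E" "v \<in> side E l d"
    using side_cover[OF v(1) edge_V(1)[OF l(1)] v(2)] .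
  have "d = m" using l d(1) by (metis Image_singleton_iff card_1_singletonE singletonD)
  then show False using d(2) s v(3) by simp
qed

lemma side_has_leaf:
  assumes "(v, c) \<in> E"
  obtains l where "l \<in> side E v c" "card (E `` {l}) = 1"
proof -
  have fin: "finite (side E v c)" if "(v, c) \<in> E" for v c
    using side_V edge_V that finite_V by (meson finite_subset subsetI)
  have "\<exists>l\<in>side E v c. card (E `` {l}) = 1"
    using assms
  proof (induction "card (side E v c)" arbitrary: v c rule: less_induct)
    case less
    show ?case
    proof (cases "E `` {c} = {v}")
      case True
      then show ?thesis by (intro bexI[of _ c]) (auto intro: in_side_self)
    next
      case False
      then obtain d where d: "(c, d) \<in> E" "d \<noteq> v" using edge_sym[OF less.prems] by auto
      have sub: "side E c d \<subset> side E v c" by (rule side_psubset[OF less.prems d])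
      then show ?thesis using less.hyps[OF psubset_card_mono[OF fin[OF less.prems] sub] d(1)] by blast
    qed
  qed
  with that show thesis by blast
qed

lemma sum_deg: "(\<Sum>v\<in>V. card (E `` {v})) = card E"
proof -
  have "E = (SIGMA v:V. E `` {v})" using E_sub by auto
  then show ?thesis using finite_V finite_nbrs card_SigmaI by metis
qed

text \<open>Handshake count: over a tree the numbers \<open>degree - 2\<close> add up to -2, and
  only the leaves contribute negatively, -1 each.\<close>

lemma card_leaf_set:
  assumes "card V \<ge> 2"
  shows "card (leaf_set V E) = 2 + (\<Sum>v | v \<in> V \<and> card (E `` {v}) \<ge> 3. card (E `` {v}) - 2)"
proof -
  let ?d = "\<lambda>v. card (E `` {v})"
  let ?B = "{v \<in> V. ?d v \<ge> 3}"
  have d1: "?d v \<ge> 1" if "v \<in> V" for v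
  proof -
    obtain u where "u \<in> V" "u \<noteq> v"
      using assms card_mono[of "{v}" V] by fastforce
    then show ?thesis using nbrs_ne that by blast
  qed
  have "(\<Sum>v\<in>V. ?d v) + (\<Sum>v\<in>V. if ?d v = 1 then 1 else 0) = (\<Sum>v\<in>V. 2 + (if ?d v \<ge> 3 then ?d v - 2 else 0))"
    unfolding sum.distrib[symmetric]
    by (rule sum.cong) (use d1 in \<open>force+\<close>)
  moreover have "(\<Sum>v\<in>V. if ?d v = 1 then 1 else 0) = card (leaf_set V E)"
    using finite_V by (simp add: leaf_set_def sum.If_cases Int_def)
  moreover have "(\<Sum>v\<in>V. 2 + (if ?d v \<ge> 3 then ?d v - 2 else 0)) = 2 * card V + (\<Sum>v\<in>?B. ?d v - 2)"
    unfolding sum.distrib using finite_V by (simp add: sum.If_cases Int_def)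
  ultimately show ?thesis using sum_deg card_E by linarith
qed

lemma move_nbrs:
  assumes "(v, c) \<in> E" "w \<noteq> v" "w \<noteq> c"
  shows "move E v c w `` {v} = E `` {v} - {c}" "move E v c w `` {w} = insert c (E `` {w})"
    "move E v c w `` {c} = insert w (E `` {c} - {v})"
    "u \<noteq> v \<Longrightarrow> u \<noteq> w \<Longrightarrow> u \<noteq> c \<Longrightarrow> move E v c w `` {u} = E `` {u}"
  using assms edge_neq[OF assms(1)] by (auto simp: move_def)

lemma not_side_not_nbr:
  assumes "(v, c) \<in> E" "w \<notin> side E v c" "w \<noteq> v"
  shows "w \<noteq> c" "(c, w) \<notin> E" "(w, c) \<notin> E"
  using assms side_closed[OF in_side_self, of c w v] in_side_self[of c v] edge_sym[of w c] edge_neq[OF assms(1)]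
  by auto

text \<open>Vertices outside the branch keep their connection to \<open>v\<close>. As
  \<open>w\<close> is one of them, the branch now hung on \<open>w\<close> is still reached, and one
  edge has replaced one edge.\<close>

lemma move_tree:
  assumes e: "(v, c) \<in> E" and w: "w \<in> V" "w \<noteq> v" "w \<notin> side E v c"
  shows "rel_tree V (move E v c w)"
proof -
  let ?F = "move E v c w"
  note nw = not_side_not_nbr[OF e w(3,2)]
  have "sym (E - {(v, c), (c, v)})" using sym_E by (auto simp: sym_def)
  then have sF: "sym ?F" by (auto simp: move_def sym_def)
  have r: "(a, b) \<in> ?F\<^sup>*" if "b \<in> side E v a" for a b
  proof -
    have "{(a, b) \<in> E. a \<noteq> v \<and> b \<noteq> v} \<subseteq> ?F" by (auto simp: move_def)
    then show ?thesis using that unfolding side_def mem_Collect_eq by (rule rtrancl_mono[THEN subsetD])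
  qed
  have out: "(v, u) \<in> ?F\<^sup>*" if u: "u \<in> V" "u \<notin> side E v c" for u
  proof (cases "u = v")
    case False
    obtain d where d: "(v, d) \<in> E" "u \<in> side E v d"
      using side_cover[OF u(1) _ False] edge_V[OF e] by blast
    then have "(v, d) \<in> ?F" using u edge_neq[OF e] by (auto simp: move_def)
    with r[OF d(2)] show ?thesis by (meson converse_rtrancl_into_rtrancl)
  qed simp
  have vc: "(v, c) \<in> ?F\<^sup>*"
    using out[OF w(1,3)] by (rule rtrancl_into_rtrancl) (simp add: move_def)
  have v: "(v, u) \<in> ?F\<^sup>*" if "u \<in> V" for u
    using out[OF that] rtrancl_trans[OF vc r] by blast
  have "(a, b) \<in> ?F\<^sup>*" if "a \<in> V" "b \<in> V" for a b
    using v[OF that(2)] symD[OF sym_rtrancl[OF sF] v[OF that(1)]] by (rule rtrancl_trans[rotated])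
  moreover have "card ?F = card E"
  proof -
    have n: "v \<noteq> c" "w \<noteq> c" using edge_neq[OF e] nw by auto
    have "{(v, c), (c, v)} \<subseteq> E" using e edge_sym[OF e] by auto
    then have "card (E - {(v, c), (c, v)}) + 2 = card E"
      using n card_mono[OF finite_E, of "{(v, c), (c, v)}"] by (simp add: card_Diff_subset)
    moreover have "card ?F = card (E - {(v, c), (c, v)}) + card {(w, c), (c, w)}"
      unfolding move_def using finite_E nw by (intro card_Un_disjoint) auto
    ultimately show ?thesis using n by simp
  qed
  moreover have "?F \<subseteq> V \<times> V" using E_sub w(1) edge_V[OF e] by (auto simp: move_def)
  moreover have "irrefl ?F" using irrefl_E nw by (auto simp: move_def irrefl_def)
  ultimately show ?thesis
    using finite_V V_ne card_E sF by (unfold_locales) auto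
qed

lemma move_degrees:
  assumes e: "(v, c) \<in> E" and w: "w \<noteq> v" "w \<notin> side E v c"
  shows "card (move E v c w `` {v}) = card (E `` {v}) - 1"
    "card (move E v c w `` {w}) = card (E `` {w}) + 1"
    "u \<noteq> v \<Longrightarrow> u \<noteq> w \<Longrightarrow> card (move E v c w `` {u}) = card (E `` {u})"
proof -
  note nw = not_side_not_nbr[OF e w(2,1)]
  note N = move_nbrs[OF e w(1) nw(1)]
  show "card (move E v c w `` {v}) = card (E `` {v}) - 1" using e by (simp add: N)
  show "card (move E v c w `` {w}) = card (E `` {w}) + 1" using nw finite_nbrs by (simp add: N)
  show "card (move E v c w `` {u}) = card (E `` {u})" if "u \<noteq> v" "u \<noteq> w"
  proof (cases "u = c")
    case True
    have "v \<in> E `` {c}" "w \<notin> E `` {c}" using edge_sym[OF e] nw by auto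
    then have "card (insert w (E `` {c} - {v})) = card (E `` {c})"
      using finite_nbrs[of c] card_Suc_Diff1[of "E `` {c}" v] by simp
    then show ?thesis using True by (simp add: N)
  qed (use that N(4)[of u] in auto)
qed

text \<open>In the first alternative of \<open>d\<close> neither \<open>v\<close> nor
  \<open>w\<close> is a leaf before or after the move; in the second they trade roles,
  \<open>v\<close> becoming a leaf and \<open>w\<close> ceasing to be one.\<close>

lemma card_leaf_set_move:
  assumes e: "(v, c) \<in> E" and w: "w \<in> V" "w \<noteq> v" "w \<notin> side E v c"
    and d: "card (E `` {v}) \<ge> 3 \<and> card (E `` {w}) \<ge> 2 \<or> card (E `` {v}) = 2 \<and> card (E `` {w}) = 1"
  shows "card (leaf_set V (move E v c w)) = card (leaf_set V E)"
proof -
  note D = move_degrees[OF e w(2,3)]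
  have v: "v \<in> V" using edge_V[OF e] by simp
  from d show ?thesis
  proof
    assume d: "card (E `` {v}) \<ge> 3 \<and> card (E `` {w}) \<ge> 2"
    have "card (move E v c w `` {u}) = 1 \<longleftrightarrow> card (E `` {u}) = 1" for u
      using D d by (cases "u = v"; cases "u = w") auto
    then show ?thesis by (simp add: leaf_set_def)
  next
    assume d: "card (E `` {v}) = 2 \<and> card (E `` {w}) = 1"
    have "card (move E v c w `` {u}) = 1 \<longleftrightarrow> u = v \<or> u \<noteq> w \<and> card (E `` {u}) = 1" for u
      using D(1,2) D(3)[of u] d w(2) by (cases "u = v"; cases "u = w") auto
    then have "leaf_set V (move E v c w) = insert v (leaf_set V E - {w})"
      using v by (auto simp: leaf_set_def)
    moreover have "w \<in> leaf_set V E" "v \<notin> leaf_set V E" "finite (leaf_set V E)"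
      using d w finite_V by (auto simp: leaf_set_def)
    ultimately show ?thesis using card_Suc_Diff1[of "leaf_set V E" w] by simp
  qed
qed

text \<open>Two vertices occupy at most two of the three or more branches at
  \<open>v\<close>.\<close>

lemma nbr_avoiding_two:
  assumes "card (E `` {v}) \<ge> 3" "v \<in> V" "y \<in> V" "z \<in> V" "y \<noteq> v" "z \<noteq> v"
  obtains c where "(v, c) \<in> E" "y \<notin> side E v c" "z \<notin> side E v c"
proof -
  obtain p q where p: "(v, p) \<in> E" "y \<in> side E v p" and q: "(v, q) \<in> E" "z \<in> side E v q"
    using side_cover assms by metis
  have "card {p, q} < card (E `` {v})" using assms(1) by (auto simp: card_insert_if)
  then have "\<not> E `` {v} \<subseteq> {p, q}" using card_mono[of "{p, q}" "E `` {v}"] by auto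
  then obtain c where c: "(v, c) \<in> E" "c \<noteq> p" "c \<noteq> q" by auto
  show thesis using that[OF c(1)] side_unique[OF p(1) c(1) p(2)] side_unique[OF q(1) c(1) q(2)] c by blast
qed

end

section \<open>Sign conditions at an extremal tree\<close>

text \<open>For a tree relation this is the quadratic form of the adjacency matrix of the tree,
  twice the sum over its unordered edges; hence the factors 2 and 4 later on.\<close>

definition pair_sum :: "('a \<times> 'a) set \<Rightarrow> ('a \<Rightarrow> real) \<Rightarrow> real" where
  "pair_sum F y = (\<Sum>(u, v)\<in>F. y u * y v)"

lemma (in rel_tree) pair_sum_nbrs: "pair_sum E y = (\<Sum>u\<in>V. y u * sum y (E `` {u}))"
proof -
  have "E = (SIGMA v:V. E `` {v})" using E_sub by auto
  then have "pair_sum E y = (\<Sum>(u, v)\<in>(SIGMA v:V. E `` {v}). y u * y v)"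
    unfolding pair_sum_def by simp
  also have "\<dots> = (\<Sum>u\<in>V. y u * sum y (E `` {u}))"
    using finite_V finite_nbrs by (subst sum.Sigma[symmetric]) (auto simp: sum_distrib_left)
  finally show ?thesis .
qed

lemma (in rel_tree) pair_sum_move:
  assumes e: "(v, c) \<in> E" and w: "w \<noteq> v" "w \<notin> side E v c"
  shows "pair_sum (move E v c w) y = pair_sum E y + 2 * (y c * (y w - y v))"
proof -
  note nw = not_side_not_nbr[OF e w(2,1)]
  have vc: "v \<noteq> c" using edge_neq[OF e] .
  let ?R = "E - {(v, c), (c, v)}"
  have "pair_sum (move E v c w) y = pair_sum ?R y + pair_sum {(w, c), (c, w)} y"
    unfolding pair_sum_def move_def using finite_E nw by (intro sum.union_disjoint) auto
  moreover have "pair_sum E y = pair_sum ?R y + pair_sum {(v, c), (c, v)} y"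
    unfolding pair_sum_def using finite_E e edge_sym[OF e] by (intro sum.subset_diff) auto
  ultimately show ?thesis using nw vc by (simp add: pair_sum_def algebra_simps)
qed

text \<open>
  The shifted index \<open>L = \<lambda>\<^sub>1 + 1\<close> turns the eigenvalue equation of \<open>J - I - 2 A(T)\<close> into \<open>eig\<close>; \<open>ray\<close>
  is the Rayleigh bound for all competing trees, and \<open>ray_eq\<close> its equality case.
\<close>

locale extremal_tree = rel_tree V E for V :: "'a set" and E +
  fixes x :: "'a \<Rightarrow> real" and L :: real
  assumes L_pos: "L > 0"
    and eig: "\<And>v. v \<in> V \<Longrightarrow> L * x v = sum x V - 2 * sum x (E `` {v})"
    and x_ne: "\<exists>v\<in>V. x v \<noteq> 0"
    and S_nonneg: "sum x V \<ge> 0"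
    and ray: "\<And>F y. rel_tree V F \<Longrightarrow> card (leaf_set V F) = card (leaf_set V E) \<Longrightarrow>
      (sum y V)\<^sup>2 - 2 * pair_sum F y \<le> L * (\<Sum>v\<in>V. (y v)\<^sup>2)"
    and ray_eq: "\<And>F v. rel_tree V F \<Longrightarrow> card (leaf_set V F) = card (leaf_set V E) \<Longrightarrow>
      (sum x V)\<^sup>2 - 2 * pair_sum F x = L * (\<Sum>v\<in>V. (x v)\<^sup>2) \<Longrightarrow> v \<in> V \<Longrightarrow>
      L * x v = sum x V - 2 * sum x (F `` {v})"
begin

lemma rayleigh_E: "(sum x V)\<^sup>2 - 2 * pair_sum E x = L * (\<Sum>v\<in>V. (x v)\<^sup>2)"
proof -
  have "2 * pair_sum E x = (\<Sum>v\<in>V. 2 * (x v * sum x (E `` {v})))"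
    by (simp only: pair_sum_nbrs sum_distrib_left)
  moreover have "(sum x V)\<^sup>2 = (\<Sum>v\<in>V. x v * sum x V)"
    by (simp only: power2_eq_square sum_distrib_right)
  ultimately have "(sum x V)\<^sup>2 - 2 * pair_sum E x = (\<Sum>v\<in>V. x v * sum x V) - (\<Sum>v\<in>V. 2 * (x v * sum x (E `` {v})))"
    by simp
  also have "\<dots> = (\<Sum>v\<in>V. x v * (sum x V - 2 * sum x (E `` {v})))"
    by (simp add: sum_subtractf[symmetric] algebra_simps)
  also have "\<dots> = (\<Sum>v\<in>V. x v * (L * x v))" using eig by (intro sum.cong) auto
  finally show ?thesis by (simp add: sum_distrib_left power2_eq_square mult_ac)
qed

lemma pair_sum_le:
  assumes "rel_tree V F" "card (leaf_set V F) = card (leaf_set V E)"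
  shows "pair_sum E x \<le> pair_sum F x"
  using ray[OF assms, of x] rayleigh_E by simp

lemma pair_sum_eq:
  assumes "rel_tree V F" "card (leaf_set V F) = card (leaf_set V E)" "pair_sum F x = pair_sum E x" "v \<in> V"
  shows "sum x (F `` {v}) = sum x (E `` {v})"
  using ray_eq[OF assms(1,2) _ assms(4)] eig[OF assms(4)] rayleigh_E assms(3) by simp

text \<open>Extremality gives the weak inequality. If the product is 0, \<open>x\<close> also
  satisfies the equations of the moved tree: comparing at \<open>v\<close>, which loses
  \<open>c\<close>, gives \<open>x c = 0\<close>; comparing at \<open>c\<close>, which trades
  \<open>v\<close> for \<open>w\<close>, gives \<open>x w = x v\<close>.\<close>

lemma move_sign:
  assumes e: "(v, c) \<in> E" and w: "w \<in> V" "w \<noteq> v" "w \<notin> side E v c"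
    and d: "card (E `` {v}) \<ge> 3 \<and> card (E `` {w}) \<ge> 2 \<or> card (E `` {v}) = 2 \<and> card (E `` {w}) = 1"
  shows "x c * (x w - x v) > 0 \<or> x c = 0 \<and> x w = x v"
proof -
  note t = move_tree[OF e w] card_leaf_set_move[OF e w d]
  note nw = not_side_not_nbr[OF e w(3,2)]
  have ge: "x c * (x w - x v) \<ge> 0"
    using pair_sum_le[OF t] pair_sum_move[OF e w(2,3), of x] by simp
  show ?thesis
  proof (cases "x c * (x w - x v) = 0")
    case True
    then have q: "pair_sum (move E v c w) x = pair_sum E x"
      using pair_sum_move[OF e w(2,3), of x] by simp
    have "sum x (E `` {v} - {c}) = sum x (E `` {v})"
      using pair_sum_eq[OF t q edge_V(1)[OF e]] move_nbrs[OF e w(2) nw(1)] by simp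
    then have c: "x c = 0" using e finite_nbrs[of v] by (simp add: sum_diff1)
    have "sum x (insert w (E `` {c} - {v})) = sum x (E `` {c})"
      using pair_sum_eq[OF t q edge_V(2)[OF e]] move_nbrs[OF e w(2) nw(1)] by simp
    then have "x w = x v" using edge_sym[OF e] finite_nbrs[of c] nw by (simp add: sum_diff1)
    with c show ?thesis by simp
  next
    case False
    with ge have "x c * (x w - x v) > 0" by (rule le_neq_trans[OF _ not_sym])
    then show ?thesis ..
  qed
qed

text \<open>
  In case of equality the neighbours of \<open>v\<close> away from \<open>z\<close> have value 0 and may be moved to any internal
  vertex outside their branch, so all internal vertices have the same value; this forces \<open>x = 0\<close>.
\<close>

lemma branching_values_differ:
  assumes v: "v \<in> V" "card (E `` {v}) \<ge> 3" and z: "z \<in> V" "z \<noteq> v" "card (E `` {z}) \<ge> 2"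
  shows "x z \<noteq> x v"
proof
  assume eq: "x z = x v"
  obtain p where p: "(v, p) \<in> E" "z \<in> side E v p" using side_cover[OF z(1) v(1) z(2)] .
  have away: "z \<notin> side E v c" if "(v, c) \<in> E" "c \<noteq> p" for c
    using side_unique[OF p(1) that(1) p(2)] that(2) by blast
  have zero: "x c = 0" if c: "(v, c) \<in> E" "c \<noteq> p" for c
    using move_sign[OF c(1) z(1,2) away[OF c]] v z eq by auto
  have same: "x u = x v" if c: "(v, c) \<in> E" "c \<noteq> p" and u: "u \<in> V" "u \<notin> side E v c" "card (E `` {u}) \<ge> 2" for c u
    using move_sign[OF c(1) u(1) _ u(2)] v u(3) zero[OF c] by (cases "u = v") auto
  \<comment> \<open>Two branches away from \<open>z\<close> are taken because an internal vertex may
    lie in one of them, but is then outside the other.\<close>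
  have "card (E `` {v} - {p}) \<ge> 2" using v p finite_nbrs[of v] by simp
  then obtain c c' where c: "(v, c) \<in> E" "c \<noteq> p" "(v, c') \<in> E" "c' \<noteq> p" "c \<noteq> c'"
    by (auto simp: numeral_2_eq_2 card_le_Suc_iff)
  have int: "x u = x v" if "u \<in> V" "card (E `` {u}) \<ge> 2" for u
    using same[OF c(1,2) that(1) _ that(2)] same[OF c(3,4) that(1) _ that(2)]
      side_unique[OF c(1,3)] c(5) by metis
  have pint: "card (E `` {p}) \<ge> 2"
  proof (rule ccontr)
    assume "\<not> ?thesis"
    then have "card (E `` {p}) = 1" using nbrs_ne[of p v] edge_V[OF p(1)] edge_neq[OF p(1)] by auto
    then show False using leaf_side[OF p(1)] p(2) z(3) by auto
  qed
  have "sum x (E `` {v}) = x p + sum x (E `` {v} - {p})"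
    using p(1) finite_nbrs by (intro sum.remove) auto
  also have "sum x (E `` {v} - {p}) = 0" using zero by (intro sum.neutral) auto
  finally have v_eq: "L * x v = sum x V - 2 * x v" using eig[OF v(1)] int[OF _ pint] edge_V[OF p(1)] by simp
  have leaf: "L * x l = sum x V - 2 * x v" if l: "l \<in> V" "\<not> card (E `` {l}) \<ge> 2" for l
  proof -
    have lv: "l \<noteq> v" using l v by auto
    then have "card (E `` {l}) = 1" using nbrs_ne[of l v] v(1) l by auto
    then obtain m where m: "E `` {l} = {m}" by (auto simp: card_1_singleton_iff)
    have mV: "m \<in> V" "(l, m) \<in> E" using m E_sub by auto
    have "card (E `` {m}) \<ge> 2"
      using leaf_nbr_internal[OF mV(2) _ v(1) lv[symmetric]] m v by (cases "v = m") auto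
    then show ?thesis using int[OF mV(1)] eig[OF l(1)] m by simp
  qed
  \<comment> \<open>If \<open>c\<close> is a leaf, its equation says that S - 2 x v is 0, which is
    also the right-hand side of the equation at \<open>v\<close>.\<close>
  have v0: "x v = 0"
  proof (cases "card (E `` {c}) \<ge> 2")
    case True
    then show ?thesis using int[of c] zero[OF c(1,2)] edge_V[OF c(1)] by simp
  next
    case False
    then have "0 = sum x V - 2 * x v" using leaf[of c] zero[OF c(1,2)] edge_V[OF c(1)] by simp
    then show ?thesis using v_eq L_pos by simp
  qed
  then have "sum x V = 0" using v_eq by simp
  then have "x u = 0" if "u \<in> V" for u
    using int[OF that] leaf[OF that] v0 L_pos by (cases "card (E `` {u}) \<ge> 2") auto
  then show False using x_ne by auto
qed

text \<open>A branch at \<open>v\<close> avoiding both \<open>y\<close> and \<open>z\<close> could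
  be moved to either, and this would force both signs on \<open>x c\<close>.\<close>

lemma branching_not_between:
  assumes v: "v \<in> V" "card (E `` {v}) \<ge> 3"
    and y: "y \<in> V" "card (E `` {y}) \<ge> 2" and z: "z \<in> V" "card (E `` {z}) \<ge> 2"
  shows "\<not> (x y < x v \<and> x v < x z)"
proof
  assume a: "x y < x v \<and> x v < x z"
  then have n: "y \<noteq> v" "z \<noteq> v" by auto
  obtain c where c: "(v, c) \<in> E" "y \<notin> side E v c" "z \<notin> side E v c"
    using nbr_avoiding_two[OF v(2,1) y(1) z(1) n] .
  have "x c * (x y - x v) > 0" "x c * (x z - x v) > 0"
    using move_sign[OF c(1) y(1) n(1) c(2)] move_sign[OF c(1) z(1) n(2) c(3)] v y z a by auto
  then show False using a by (simp add: zero_less_mult_iff)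
qed

text \<open>
  The constant \<open>a\<close> bounds the sum of \<open>x\<close> over any two vertices. One step of the eigenvalue equation
  bounds \<open>- x\<close> by multiples of \<open>a\<close>, and a second step bounds \<open>a\<close> by itself.
\<close>

lemma hub_bound:
  assumes w: "w \<in> V" "card (E `` {w}) \<ge> 2" "\<And>d. (w, d) \<in> E \<Longrightarrow> d \<noteq> cw \<Longrightarrow> x d \<ge> 0"
    and v: "v \<in> V" "card (E `` {v}) \<ge> 2" "\<And>d. (v, d) \<in> E \<Longrightarrow> d \<noteq> cv \<Longrightarrow> x d \<le> 0"
    and vw: "v \<noteq> w" and rest: "\<And>u. u \<in> V \<Longrightarrow> u \<noteq> v \<Longrightarrow> u \<noteq> w \<Longrightarrow> card (E `` {u}) \<le> 2"
    and u: "u \<in> V" "u \<noteq> w" "x u < 0"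
  obtains a where "a > 0" "sum x V < 2 * a" "\<And>i. i \<in> V \<Longrightarrow> i \<noteq> v \<Longrightarrow> 2 * x i \<le> a"
    "L\<^sup>2 * a \<le> 4 * (real (card (E `` {w})) + real (card (E `` {v}))) * a
       + (2 * L - 2 * real (card (E `` {v})) - 4) * sum x V"
proof -
  define S where "S = sum x V"
  define d1 where "d1 = real (card (E `` {w}))"
  define d2 where "d2 = real (card (E `` {v}))"
  define p where "p = Max (insert 0 (x ` (V - {v})))"
  define U where "U = max 0 (x v)"
  \<comment> \<open>Only \<open>v\<close> may exceed \<open>p\<close>, and it occurs at most once in
    a neighbourhood; so its value enters \<open>a\<close> once.\<close>
  define a where "a = p + max U p"
  have d: "d1 \<ge> 2" "d2 \<ge> 2" using w v by (auto simp: d1_def d2_def)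
  have S0: "S \<ge> 0" using S_nonneg by (simp add: S_def)
  have p0: "p \<ge> 0" and px: "\<And>i. i \<in> V \<Longrightarrow> i \<noteq> v \<Longrightarrow> x i \<le> p"
    unfolding p_def using finite_V by auto
  have pU: "2 * p \<le> a" "U + p \<le> a" by (auto simp: a_def)
  \<comment> \<open>Here \<open>m >= 2\<close> allows the excess of \<open>v\<close> to be paired
    with one other vertex.\<close>
  have up: "2 * sum x N \<le> m * a" if N: "N \<subseteq> V" "real (card N) \<le> m" "m \<ge> 2" for N m
  proof -
    have fin: "finite N" using N(1) finite_V finite_subset by blast
    have mp: "(m - 2) * (2 * p) \<le> (m - 2) * a" using pU N(3) by (intro mult_left_mono) auto
    show ?thesis
    proof (cases "v \<in> N")
      case False
      have "sum x N \<le> real (card N) * p" by (rule sum_bounded_above) (use px N False in auto)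
      also have "\<dots> \<le> m * p" using N p0 by (intro mult_right_mono) auto
      finally show ?thesis using mp pU by (simp add: algebra_simps)
    next
      case True
      have "sum x (N - {v}) \<le> real (card (N - {v})) * p" by (rule sum_bounded_above) (use px N in auto)
      also have "\<dots> \<le> (m - 1) * p" using N p0 True fin
        by (intro mult_right_mono) (auto simp: card_Diff_singleton of_nat_diff Suc_leI card_gt_0_iff)
      finally have "sum x N \<le> U + (m - 1) * p" using sum.remove[OF fin True, of x] by (simp add: U_def)
      then show ?thesis using mp pU by (simp add: algebra_simps)
    qed
  qed
  have NV: "E `` {i} \<subseteq> V" for i using E_sub by auto
  \<comment> \<open>The hub \<open>v\<close> may have many neighbours, but only \<open>cv\<close>
    can be positive, so its neighbourhood is no worse than that of a vertex of degree 2.\<close>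
  have v_up: "2 * sum x (E `` {v}) \<le> 2 * a"
  proof -
    have "sum x (E `` {v}) \<le> p"
    proof (cases "(v, cv) \<in> E")
      case True
      then have "sum x (E `` {v}) = x cv + sum x (E `` {v} - {cv})"
        using finite_nbrs by (intro sum.remove) auto
      moreover have "sum x (E `` {v} - {cv}) \<le> 0" using v(3) by (intro sum_nonpos) auto
      moreover have "x cv \<le> p" using px edge_V[OF True] edge_neq[OF True] by auto
      ultimately show ?thesis by simp
    next
      case False
      then have "sum x (E `` {v}) \<le> 0" using v(3) by (intro sum_nonpos) auto
      then show ?thesis using p0 by simp
    qed
    then show ?thesis using pU p0 by simp
  qed
  have nb: "2 * sum x (E `` {i}) \<le> 2 * a" if "i \<in> V" "i \<noteq> w" for i
    using v_up up[OF NV, of i 2] rest[of i] that by (cases "i = v") auto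
  \<comment> \<open>The equation at the negative vertex \<open>u\<close> is what limits the total
    sum.\<close>
  have Sa: "S < 2 * a"
  proof -
    have "L * x u < 0" using L_pos u(3) by (simp add: mult_less_0_iff)
    then show ?thesis using eig[OF u(1)] nb[OF u(1,2)] by (simp add: S_def)
  qed
  have a0: "a > 0" using Sa S0 by simp
  \<comment> \<open>First round of the equation: \<open>\<beta>\<close> bounds \<open>- x\<close>
    off \<open>w\<close>, and \<open>\<omega>\<close> bounds it at \<open>w\<close>, whose
    \<open>d1\<close> neighbours may all be positive.\<close>
  define \<beta> where "\<beta> = (2 * a - S) / L"
  define \<omega> where "\<omega> = (d1 * a - S) / L"
  have b0: "\<beta> \<ge> 0" using Sa L_pos by (simp add: \<beta>_def)
  have "2 * a \<le> d1 * a" using d a0 by simp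
  then have wb: "\<beta> \<le> \<omega>" using L_pos by (simp add: \<beta>_def \<omega>_def divide_right_mono)
  have lo: "- x i \<le> \<beta>" if "i \<in> V" "i \<noteq> w" for i
    using nb[OF that] eig[OF that(1)] L_pos by (simp add: \<beta>_def field_simps S_def)
  have low: "- x w \<le> \<omega>"
    using up[OF NV, of w d1] eig[OF w(1)] d L_pos by (simp add: \<omega>_def field_simps S_def d1_def)
  have dn: "- sum x N \<le> \<omega> + (m - 1) * \<beta>" if N: "N \<subseteq> V" "real (card N) \<le> m" "m \<ge> 1" for N m
  proof -
    have fin: "finite N" using N(1) finite_V finite_subset by blast
    show ?thesis
    proof (cases "w \<in> N")
      case False
      have "(\<Sum>i\<in>N. - x i) \<le> real (card N) * \<beta>" by (rule sum_bounded_above) (use lo N False in auto)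
      also have "\<dots> \<le> m * \<beta>" using N b0 by (intro mult_right_mono) auto
      finally show ?thesis using wb by (simp add: sum_negf algebra_simps)
    next
      case True
      have "(\<Sum>i\<in>N - {w}. - x i) \<le> real (card (N - {w})) * \<beta>" by (rule sum_bounded_above) (use lo N in auto)
      also have "\<dots> \<le> (m - 1) * \<beta>" using N b0 True fin
        by (intro mult_right_mono) (auto simp: card_Diff_singleton of_nat_diff Suc_leI card_gt_0_iff)
      finally show ?thesis using sum.remove[OF fin True, of x] low by (simp add: sum_negf algebra_simps)
    qed
  qed
  have w_dn: "- sum x (E `` {w}) \<le> \<beta>"
  proof (cases "(w, cw) \<in> E")
    case True
    then have "sum x (E `` {w}) = x cw + sum x (E `` {w} - {cw})"
      using finite_nbrs by (intro sum.remove) auto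
    moreover have "sum x (E `` {w} - {cw}) \<ge> 0" using w(3) by (intro sum_nonneg) auto
    moreover have "- x cw \<le> \<beta>" using lo edge_V[OF True] edge_neq[OF True] by auto
    ultimately show ?thesis by simp
  next
    case False
    then have "sum x (E `` {w}) \<ge> 0" using w(3) by (intro sum_nonneg) auto
    then show ?thesis using b0 by simp
  qed
  \<comment> \<open>Second round: off \<open>v\<close> a neighbourhood costs at most
    \<open>w\<close> and one more vertex, while at \<open>v\<close> all \<open>d2\<close> neighbours
    may be negative.\<close>
  have xp: "L * x i \<le> S + 2 * \<omega> + 2 * \<beta>" if i: "i \<in> V" "i \<noteq> v" for i
  proof -
    have "- sum x (E `` {i}) \<le> \<omega> + \<beta>"
      using w_dn wb b0 dn[OF NV, of i 2] rest[of i] i by (cases "i = w") auto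
    then show ?thesis using eig[OF i(1)] by (simp add: S_def)
  qed
  have "p \<in> insert 0 (x ` (V - {v}))" unfolding p_def by (rule Max_in) (use finite_V in auto)
  then have Lp: "L * p \<le> S + 2 * \<omega> + 2 * \<beta>" using xp S0 wb b0 by auto
  have mono: "2 * \<beta> \<le> 2 * ((d2 - 1) * \<beta>)" using mult_right_mono[of 1 "d2 - 1" \<beta>] d b0 by simp
  have "L * x v \<le> S + 2 * \<omega> + 2 * ((d2 - 1) * \<beta>)"
    using dn[OF NV, of v d2] eig[OF v(1)] d by (simp add: S_def d2_def)
  then have LU: "L * U \<le> S + 2 * \<omega> + 2 * ((d2 - 1) * \<beta>)"
    using S0 wb b0 mono by (auto simp: U_def max_def)
  have "L * max U p \<le> S + 2 * \<omega> + 2 * ((d2 - 1) * \<beta>)"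
    using LU Lp mono by (auto simp: max_def)
  with Lp have "L * a \<le> 2 * S + 4 * \<omega> + 2 * (d2 * \<beta>)"
    by (simp add: a_def algebra_simps)
  then have "L * (L * a) \<le> L * (2 * S + 4 * \<omega> + 2 * (d2 * \<beta>))"
    using L_pos by (intro mult_left_mono) auto
  also have "\<dots> = 2 * L * S + 4 * (L * \<omega>) + 2 * d2 * (L * \<beta>)" by (simp add: algebra_simps)
  also have "\<dots> = 2 * L * S + 4 * (d1 * a - S) + 2 * d2 * (2 * a - S)"
    using L_pos by (simp add: \<omega>_def \<beta>_def)
  finally have "L\<^sup>2 * a \<le> 4 * (d1 + d2) * a + (2 * L - 2 * d2 - 4) * S"
    by (simp add: power2_eq_square algebra_simps)
  moreover have "2 * x i \<le> a" if "i \<in> V" "i \<noteq> v" for i using px[OF that] pU by simp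
  ultimately show thesis using that[of a] a0 Sa by (simp add: S_def d1_def d2_def)
qed

end

section \<open>Lower bounds for the index\<close>

text \<open>Used with \<open>\<pi> i < i\<close>, so that 0 is the root; both orientations are kept
  to fit \<open>rel_tree\<close>.\<close>

definition parent_rel :: "nat \<Rightarrow> (nat \<Rightarrow> nat) \<Rightarrow> (nat \<times> nat) set" where
  "parent_rel n \<pi> = (\<lambda>i. (i, \<pi> i)) ` {1..<n} \<union> (\<lambda>i. (\<pi> i, i)) ` {1..<n}"

lemma parent_rel_disjoint:
  fixes n :: nat
  assumes "\<And>i. 1 \<le> i \<Longrightarrow> i < n \<Longrightarrow> \<pi> i < i"
  shows "(\<lambda>i. (i, \<pi> i)) ` {1..<n} \<inter> (\<lambda>i. (\<pi> i, i)) ` {1..<n} = {}"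
proof -
  have "\<pi> (\<pi> i) \<noteq> i" if "1 \<le> i" "i < n" "1 \<le> \<pi> i" for i
    using assms[of i] assms[of "\<pi> i"] that by auto
  then show ?thesis by auto
qed

lemma rel_tree_parent_rel:
  assumes n: "0 < n" and \<pi>: "\<And>i. 1 \<le> i \<Longrightarrow> i < n \<Longrightarrow> \<pi> i < i"
  shows "rel_tree {..<n} (parent_rel n \<pi>)"
proof -
  let ?E = "parent_rel n \<pi>"
  have s: "sym ?E" by (auto simp: parent_rel_def sym_def)
  have root: "(0, i) \<in> ?E\<^sup>*" if "i < n" for i
    using that
  proof (induction i rule: less_induct)
    case (less i)
    show ?case
    proof (cases "i = 0")
      case False
      then have i: "1 \<le> i" by simp
      have "(0, \<pi> i) \<in> ?E\<^sup>*" using less.IH[OF \<pi>[OF i less.prems]] \<pi>[OF i less.prems] less.prems by simp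
      moreover have "(\<pi> i, i) \<in> ?E" using i less.prems by (auto simp: parent_rel_def)
      ultimately show ?thesis by (rule rtrancl_into_rtrancl)
    qed simp
  qed
  have "(u, v) \<in> ?E\<^sup>*" if "u < n" "v < n" for u v
    using symD[OF sym_rtrancl[OF s] root[OF that(1)]] root[OF that(2)] by (rule rtrancl_trans)
  moreover have "card ?E = (n - 1) + (n - 1)"
    unfolding parent_rel_def
    by (subst card_Un_disjoint) (use parent_rel_disjoint[OF \<pi>] in \<open>auto simp: card_image inj_on_def\<close>)
  moreover have "?E \<subseteq> {..<n} \<times> {..<n}" using \<pi> by (fastforce simp: parent_rel_def)
  moreover have "irrefl ?E" using \<pi> by (fastforce simp: parent_rel_def irrefl_def)
  ultimately show ?thesis using s n by unfold_locales auto
qed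

lemma pair_sum_parent_rel:
  assumes "\<And>i. 1 \<le> i \<Longrightarrow> i < n \<Longrightarrow> \<pi> i < i"
  shows "pair_sum (parent_rel n \<pi>) y = 2 * (\<Sum>i=1..<n. y i * y (\<pi> i))"
  unfolding pair_sum_def parent_rel_def
  by (subst sum.union_disjoint[OF _ _ parent_rel_disjoint[OF assms]])
    (auto simp: sum.reindex inj_on_def mult.commute)

text \<open>Describes \<open>T_star\<close> rooted at its hub 0, as \<open>adj_T_star\<close>
  confirms; vertex \<open>k\<close> is the last neighbour of the hub and the start of the
  tail.\<close>

definition broom_parent :: "nat \<Rightarrow> nat \<Rightarrow> nat" where
  "broom_parent k i = (if i \<le> k then 0 else i - 1)"

abbreviation "broom n k \<equiv> parent_rel n (broom_parent k)"

lemma broom_parent_less: "1 \<le> i \<Longrightarrow> broom_parent k i < i"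
  by (auto simp: broom_parent_def)

lemma broom_iff:
  "(i, j) \<in> broom n k \<longleftrightarrow> 1 \<le> i \<and> i < n \<and> j = broom_parent k i \<or> 1 \<le> j \<and> j < n \<and> i = broom_parent k j"
  by (auto simp: parent_rel_def)

lemma leaf_set_broom:
  assumes k: "2 \<le> k" "k + 2 \<le> n"
  shows "leaf_set {..<n} (broom n k) = insert (n - 1) {1..<k}"
proof -
  have 0: "broom n k `` {0} = {1..k}" using k by (auto simp: broom_iff broom_parent_def split: if_splits)
  have 1: "broom n k `` {i} = {0}" if "1 \<le> i" "i < k" for i
    using k that by (auto simp: broom_iff broom_parent_def split: if_splits)
  have 2: "broom n k `` {k} = {0, k + 1}" using k by (auto simp: broom_iff broom_parent_def split: if_splits)
  have 3: "broom n k `` {i} = {i - 1, i + 1}" if "k < i" "i < n - 1" for i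
    using k that by (auto simp: broom_iff broom_parent_def split: if_splits)
  have 4: "broom n k `` {n - 1} = {n - 2}" using k by (auto simp: broom_iff broom_parent_def split: if_splits)
  have "card (broom n k `` {i}) = 1 \<longleftrightarrow> i = n - 1 \<or> 1 \<le> i \<and> i < k" if i: "i < n" for i
  proof -
    consider "i = 0" | "1 \<le> i" "i < k" | "i = k" | "k < i" "i < n - 1" | "i = n - 1"
      using i by linarith
    then show ?thesis
      using k by cases (simp_all add: 0 1 2 3 4[simplified])
  qed
  then show ?thesis using k by (auto simp: leaf_set_def)
qed

locale extremal_nat_tree = extremal_tree "{..<n}" E x L for n :: nat and E x L
begin

lemma broom_bound:
  assumes k: "2 \<le> card (leaf_set {..<n} E)" "card (leaf_set {..<n} E) + 2 \<le> n"
  shows "(\<Sum>i<n. y i)\<^sup>2 - 4 * (\<Sum>i=1..<n. y i * y (broom_parent (card (leaf_set {..<n} E)) i))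
    \<le> L * (\<Sum>i<n. (y i)\<^sup>2)"
proof -
  let ?k = "card (leaf_set {..<n} E)"
  have "rel_tree {..<n} (broom n ?k)"
    using k by (intro rel_tree_parent_rel broom_parent_less) auto
  moreover have "card (leaf_set {..<n} (broom n ?k)) = card (leaf_set {..<n} E)"
  proof -
    have "n - 1 \<notin> {1..<?k}" using k by (auto simp del: One_nat_def)
    then show ?thesis using k by (simp add: leaf_set_broom[OF k] del: One_nat_def)
  qed
  ultimately show ?thesis using ray[of "broom n ?k" y] by (simp add: pair_sum_parent_rel broom_parent_less)
qed

text \<open>The test vector ignores the hub, so only the \<open>n - 1 - k\<close> edges of the tail
  are felt. With \<open>m = n - 1\<close> the quotient is \<open>m - 4 + 4 * k / m\<close>, and its
  excess over \<open>4 + k / 2\<close> has the sign of \<open>(m - 8) * (2 * m - k)\<close>.\<close>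

lemma index_ge_large:
  assumes k: "2 \<le> card (leaf_set {..<n} E)" "card (leaf_set {..<n} E) + 2 \<le> n" and n: "n \<ge> 9"
  shows "4 + real (card (leaf_set {..<n} E)) / 2 \<le> L"
proof -
  define k where "k = card (leaf_set {..<n} E)"
  have k2: "2 \<le> k" using k by (simp add: k_def)
  define y where "y i = (if i = 0 then 0 else 1 :: real)" for i :: nat
  obtain m where m: "n = Suc m" using n by (cases n) auto
  have 1: "(\<Sum>i<n. y i) = real m" unfolding m by (subst sum.lessThan_Suc_shift) (simp add: y_def)
  have 2: "(\<Sum>i<n. (y i)\<^sup>2) = real m" unfolding m by (subst sum.lessThan_Suc_shift) (simp add: y_def)
  have "(\<Sum>i=1..<n. y i * y (broom_parent k i)) = (\<Sum>i=1..<n. if k < i then 1 else 0)"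
    using k2 by (intro sum.cong) (auto simp: y_def broom_parent_def)
  also have "\<dots> = (\<Sum>i\<in>{k<..<n}. 1)"
    using k2 by (intro sum.mono_neutral_cong_right) auto
  also have "\<dots> = real (card {k<..<n})" by simp
  also have "\<dots> = real m - real k" using assms m by (simp add: k_def of_nat_diff)
  finally have "(real m)\<^sup>2 - 4 * (real m - real k) \<le> L * real m"
    using broom_bound[OF assms(1,2), of y] 1 2 by (simp add: k_def)
  moreover have "(4 + real k / 2) * real m \<le> (real m)\<^sup>2 - 4 * (real m - real k)"
  proof -
    have "(real m - 8) * (2 * real m - real k) \<ge> 0"
      using assms m by (intro mult_nonneg_nonneg) (auto simp: k_def)
    then show ?thesis by (simp add: power2_eq_square algebra_simps)
  qed
  ultimately have "(4 + real k / 2) * real m \<le> L * real m" by linarith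
  then show ?thesis using n m by (simp add: k_def)
qed

text \<open>Below nine vertices the vector that ignores the hub does not reach
  \<open>4 + k / 2\<close>, so every pair with \<open>3 <= k <= n - 2\<close> gets its own vector.
  The bounds are the Rayleigh quotients; 429/93 and 969/177 are left unreduced.\<close>

lemma index_ge_small:
  fixes k :: nat
  assumes k: "card (leaf_set {..<n} E) = k"
  shows "n = 6 \<Longrightarrow> k = 3 \<Longrightarrow> L \<ge> 21/5" "n = 6 \<Longrightarrow> k = 4 \<Longrightarrow> L \<ge> 5"
    "n = 7 \<Longrightarrow> k = 3 \<Longrightarrow> L \<ge> 429/93" "n = 7 \<Longrightarrow> k = 4 \<Longrightarrow> L \<ge> 969/177" "n = 7 \<Longrightarrow> k = 5 \<Longrightarrow> L \<ge> 6"
    "n = 8 \<Longrightarrow> k = 3 \<Longrightarrow> L \<ge> 5" "n = 8 \<Longrightarrow> k = 4 \<Longrightarrow> L \<ge> 29/5" "n = 8 \<Longrightarrow> k = 5 \<Longrightarrow> L \<ge> 45/7" "n = 8 \<Longrightarrow> k = 6 \<Longrightarrow> L \<ge> 7"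
proof -
  \<comment> \<open>the test vectors are rounded eigenvectors of the broom\<close>
  note b = broom_bound[unfolded k]
  note s = lessThan_nat_numeral atLeastLessThan_nat_numeral broom_parent_def power2_eq_square
  show "L \<ge> 21/5" if "n = 6" "k = 3"
    using b[of "\<lambda>i. [-1,1,1,1,0,1] ! i"] that by (simp add: s)
  show "L \<ge> 5" if "n = 6" "k = 4"
    using b[of "\<lambda>i. [-1,1,1,1,1,0] ! i"] that by (simp add: s)
  show "L \<ge> 429/93" if "n = 7" "k = 3"
    using b[of "\<lambda>i. [-2,5,5,5,1,2,3] ! i"] that by (simp add: s)
  show "L \<ge> 969/177" if "n = 7" "k = 4"
    using b[of "\<lambda>i. [-4,6,6,6,6,1,4] ! i"] that by (simp add: s)
  show "L \<ge> 6" if "n = 7" "k = 5"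
    using b[of "\<lambda>i. [-1,1,1,1,1,1,0] ! i"] that by (simp add: s)
  show "L \<ge> 5" if "n = 8" "k = 3"
    using b[of "\<lambda>i. [0,1,1,1,0,1,0,1] ! i"] that by (simp add: s)
  show "L \<ge> 29/5" if "n = 8" "k = 4"
    using b[of "\<lambda>i. [-1,2,2,2,2,1,1,1] ! i"] that by (simp add: s)
  show "L \<ge> 45/7" if "n = 8" "k = 5"
    using b[of "\<lambda>i. [-1,1,1,1,1,1,0,1] ! i"] that by (simp add: s)
  show "L \<ge> 7" if "n = 8" "k = 6"
    using b[of "\<lambda>i. [-1,1,1,1,1,1,1,1] ! i"] that by (simp add: s)
qed

text \<open>The middle three provide the index conditions of \<open>hub_contradiction\<close> for
  \<open>d1 + d2 = k + 2\<close>: with two branching vertices \<open>d1 <= k - 1\<close>, and with a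
  second hub of degree 2 at worst \<open>d1 = k\<close>. At \<open>n = 7\<close>,
  \<open>k = 3\<close> the vector is too weak for the last of them, and the bound 13 takes its
  place.\<close>

lemma index_bounds:
  fixes k :: nat
  assumes k: "card (leaf_set {..<n} E) = k" "3 \<le> k" "k + 2 \<le> n" and n: "6 \<le> n"
  shows "4 < L"
    and "4 \<le> k \<Longrightarrow> 4 * (real k + 2) < L\<^sup>2 \<and> 4 * (real k - 2) \<le> (L - 2)\<^sup>2"
    and "k + 3 \<le> n \<Longrightarrow> 7 \<le> n \<Longrightarrow> 4 * (real k + 2) < L\<^sup>2"
    and "k + 3 \<le> n \<Longrightarrow> 7 \<le> n \<Longrightarrow> \<not> (n = 7 \<and> k = 3) \<Longrightarrow> 4 * (real k - 1) \<le> (L - 2)\<^sup>2"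
    and "n = 7 \<Longrightarrow> k = 3 \<Longrightarrow> 13 < (L - 1)\<^sup>2"
proof -
  have mono: "r\<^sup>2 \<le> L\<^sup>2 \<and> (r - 1)\<^sup>2 \<le> (L - 1)\<^sup>2 \<and> (r - 2)\<^sup>2 \<le> (L - 2)\<^sup>2" if "r \<le> L" "2 \<le> r" for r
    using that by (auto intro!: power_mono)
  note sm = index_ge_small[OF k(1)]
  have big: "4 + real k / 2 \<le> L \<and> 4 * (real k + 2) < L\<^sup>2 \<and> 4 * (real k - 1) \<le> (L - 2)\<^sup>2" if "9 \<le> n"
  proof -
    define r where "r = 4 + real k / 2"
    have "r \<le> L" unfolding r_def using index_ge_large that k by auto
    \<comment> \<open>The second inequality amounts to
      \<open>(k / 2 - 2)^2 + 4 >= 0\<close>.\<close>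
    moreover have "4 * (real k + 2) < r\<^sup>2 \<and> 4 * (real k - 1) \<le> (r - 2)\<^sup>2"
      using zero_le_power2[of "real k / 2 - 2"] by (simp add: r_def power2_eq_square algebra_simps)
    moreover have "2 \<le> r" by (simp add: r_def)
    ultimately show ?thesis using mono[of r] r_def by linarith
  qed
  consider "n \<ge> 9" | "n = 6" "k = 3" | "n = 6" "k = 4" | "n = 7" "k = 3" | "n = 7" "k = 4" | "n = 7" "k = 5"
    | "n = 8" "k = 3" | "n = 8" "k = 4" | "n = 8" "k = 5" | "n = 8" "k = 6"
  proof -
    have "9 \<le> n \<or> n = 6 \<or> n = 7 \<or> n = 8" using n by linarith
    moreover have "n = 6 \<Longrightarrow> k = 3 \<or> k = 4" "n = 7 \<Longrightarrow> k = 3 \<or> k = 4 \<or> k = 5"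
      "n = 8 \<Longrightarrow> k = 3 \<or> k = 4 \<or> k = 5 \<or> k = 6"
      using k(2,3) by linarith+
    ultimately show thesis using that by blast
  qed
  note C = this
  show "4 < L"
    using C
  proof cases
    case 1
    then show ?thesis using big k(2) by auto
  qed (use sm in auto)
  show "4 * (real k + 2) < L\<^sup>2 \<and> 4 * (real k - 2) \<le> (L - 2)\<^sup>2" if "4 \<le> k"
    using C
  proof cases
    case 1
    then show ?thesis using big by auto
  qed (use that sm mono[of 5] mono[of "969/177"] mono[of 6] mono[of "29/5"] mono[of "45/7"] mono[of 7]
       in \<open>auto simp: power2_eq_square\<close>)
  show "4 * (real k + 2) < L\<^sup>2" if "k + 3 \<le> n" "7 \<le> n"
    using C
  proof cases
    case 1
    then show ?thesis using big by linarith
  qed (use that sm mono[of "429/93"] mono[of "969/177"] mono[of 5] mono[of "29/5"] mono[of "45/7"]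
       in \<open>auto simp: power2_eq_square\<close>)
  show "4 * (real k - 1) \<le> (L - 2)\<^sup>2" if "k + 3 \<le> n" "7 \<le> n" "\<not> (n = 7 \<and> k = 3)"
    using C
  proof cases
    case 1
    then show ?thesis using big by linarith
  qed (use that sm mono[of "969/177"] mono[of 5] mono[of "29/5"] mono[of "45/7"]
       in \<open>auto simp: power2_eq_square\<close>)
  show "13 < (L - 1)\<^sup>2" if "n = 7" "k = 3"
    using sm(3)[OF that] mono[of "429/93"] by (simp add: power2_eq_square)
qed

end

section \<open>Structure of the extremal tree\<close>

lemma hub_contradiction:
  fixes a S L d1 d2 :: real
  assumes "a > 0" "0 \<le> S" "S < 2 * a"
    and le: "L\<^sup>2 * a \<le> 4 * (d1 + d2) * a + (2 * L - 2 * d2 - 4) * S"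
    and L1: "4 * (d1 + d2) < L\<^sup>2" and L2: "4 * (d1 - 1) \<le> (L - 2)\<^sup>2"
  shows False
proof (cases "2 * L - 2 * d2 - 4 \<le> 0")
  case True
  then have "(2 * L - 2 * d2 - 4) * S \<le> 0" using assms(2) by (simp add: mult_nonpos_nonneg)
  then have "L\<^sup>2 * a \<le> 4 * (d1 + d2) * a" using le by linarith
  then show False using L1 assms(1) by simp
next
  case False
  then have "(2 * L - 2 * d2 - 4) * S \<le> (2 * L - 2 * d2 - 4) * (2 * a)"
    using assms(3) by (intro mult_left_mono) auto
  moreover have "(2 * L - 2 * d2 - 4) * S \<noteq> (2 * L - 2 * d2 - 4) * (2 * a)"
    using False assms(3) by auto
  ultimately have "L\<^sup>2 * a < (4 * (d1 + d2) + (2 * L - 2 * d2 - 4) * 2) * a"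
    using le by (simp add: algebra_simps)
  then have "L\<^sup>2 < 4 * (d1 + d2) + (2 * L - 2 * d2 - 4) * 2" using assms(1) by simp
  then show False using L2 by (simp add: power2_eq_square algebra_simps)
qed

section \<open>Signs along the legs of a single hub\<close>

context extremal_tree
begin

text \<open>At a branching vertex the degenerate alternative of \<open>move_sign\<close> is
  impossible, because \<open>x z\<close> and \<open>x v\<close> differ.\<close>

lemma away_nbr_sign:
  assumes v: "v \<in> V" "card (E `` {v}) \<ge> 3" and z: "z \<in> V" "z \<noteq> v" "card (E `` {z}) \<ge> 2"
    and c: "(v, c) \<in> E" "z \<notin> side E v c"
  shows "x c * (x z - x v) > 0"
  using move_sign[OF c(1) z(1,2) c(2)] branching_values_differ[OF v z] v z by auto

text \<open>
  Exchanging the edges \<open>b p\<close> and \<open>r l\<close> for \<open>b l\<close> and \<open>r p\<close> keeps all degrees: the leaf \<open>l\<close> is hung on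
  \<open>b\<close> and the leg of \<open>p\<close> is appended to the leg of \<open>q\<close>.
\<close>

lemma leg_swap:
  assumes b: "b \<in> V" "card (E `` {b}) \<ge> 3"
    and p: "(b, p) \<in> E" and q: "(b, q) \<in> E" "p \<noteq> q" "card (E `` {q}) \<ge> 2"
    and l: "l \<in> side E b q" "card (E `` {l}) = 1"
    and low: "\<And>z. z \<in> V \<Longrightarrow> z \<noteq> b \<Longrightarrow> card (E `` {z}) \<ge> 2 \<Longrightarrow> x b < x z"
  shows "x l < x p"
proof -
  have lV: "l \<in> V" using side_V[OF l(1)] edge_V[OF q(1)] by simp
  obtain r where r: "E `` {l} = {r}" using l(2) by (auto simp: card_1_singleton_iff)
  have lr: "(l, r) \<in> E" using r by auto
  have rl: "(r, l) \<in> E" by (rule edge_sym[OF lr])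
  have lb: "l \<noteq> b" using l b by auto
  have rb: "r \<noteq> b"
  proof
    assume "r = b"
    then have "l = q" using nbr_in_side[OF q(1) _ l(1)] rl by simp
    then show False using l q by simp
  qed
  have rq: "r \<in> side E b q" by (rule side_closed[OF l(1) lr lb rb])
  have notp: "r \<notin> side E b p" "l \<notin> side E b p"
    using side_unique[OF p q(1)] rq l(1) q(2) by blast+
  have pn: "p \<noteq> r" "p \<noteq> l" "p \<noteq> b" using notp in_side_self[of p b] edge_neq[OF p] by auto
  have r2: "card (E `` {r}) \<ge> 2"
    using leaf_nbr_internal[OF lr l(2) b(1)] lb rb by auto
  have xr: "x b < x r" by (rule low) (use edge_V[OF lr] rb r2 in auto)
  have srl: "b \<notin> side E r l" using leaf_side[OF rl l(2)] lb by simp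
  \<comment> \<open>The exchange is composed of two moves. The tree in between may have a different
    number of leaves; only the final one is compared with \<open>E\<close>.\<close>
  let ?E1 = "move E r l b"
  interpret T1: rel_tree V ?E1 by (rule move_tree[OF rl b(1) rb[symmetric] srl])
  have bp1: "(b, p) \<in> ?E1" using p pn rb lb by (auto simp: move_def)
  have "{(a, c) \<in> ?E1. a \<noteq> b \<and> c \<noteq> b} \<subseteq> {(a, c) \<in> E. a \<noteq> b \<and> c \<noteq> b}" by (auto simp: move_def)
  then have "side ?E1 b p \<subseteq> side E b p" unfolding side_def using rtrancl_mono by blast
  then have rs1: "r \<notin> side ?E1 b p" using notp by auto
  have rV: "r \<in> V" using edge_V[OF lr] by simp
  let ?E2 = "move ?E1 b p r"
  have T2: "rel_tree V ?E2" by (rule T1.move_tree[OF bp1 rV rb rs1])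
  note D1 = move_degrees[OF rl rb[symmetric] srl]
  note D2 = T1.move_degrees[OF bp1 rb rs1]
  have "card (?E2 `` {u}) = card (E `` {u})" for u
    using D1(1,2) D1(3)[of u] D2(1,2) D2(3)[of u] r2 rb by (cases "u = b"; cases "u = r") auto
  then have lv: "card (leaf_set V ?E2) = card (leaf_set V E)" by (simp add: leaf_set_def)
  have ps: "pair_sum ?E2 x = pair_sum E x + 2 * ((x r - x b) * (x p - x l))"
    using pair_sum_move[OF rl rb[symmetric] srl, of x] T1.pair_sum_move[OF bp1 rb rs1, of x]
    by (simp add: algebra_simps)
  have "(x r - x b) * (x p - x l) \<ge> 0" using pair_sum_le[OF T2 lv] ps by linarith
  then have ge: "x p \<ge> x l" using xr by (simp add: zero_le_mult_iff)
  \<comment> \<open>In case of equality the equations are compared at \<open>p\<close>, which trades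
    \<open>b\<close> for \<open>r\<close>.\<close>
  moreover have "x p \<noteq> x l"
  proof
    assume "x p = x l"
    then have "pair_sum ?E2 x = pair_sum E x" using ps by simp
    from pair_sum_eq[OF T2 lv this edge_V(2)[OF p]]
    have "sum x (?E2 `` {p}) = sum x (E `` {p})" .
    moreover have "?E2 `` {p} = insert r (?E1 `` {p} - {b})"
      using T1.move_nbrs(3)[OF bp1 rb] pn by auto
    moreover have "?E1 `` {p} = E `` {p}" using move_nbrs(4)[OF rl rb[symmetric] lb[symmetric]] pn by auto
    moreover have "r \<notin> E `` {p}"
      using side_closed[OF in_side_self, of p r b] notp pn rb by auto
    ultimately have "x r = x b"
      using edge_sym[OF p] finite_nbrs[of p] by (simp add: sum_diff1)
    then show False using xr by simp
  qed
  ultimately show ?thesis by simp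
qed

text \<open>The part of the leg beyond \<open>q\<close> can be appended to a leaf \<open>l\<close>
  of the branch through \<open>p\<close>, with \<open>q\<close> becoming a leaf instead. As
  \<open>leg_swap\<close> gives \<open>x l < x q\<close>, the sign of this move makes
  \<open>x q2\<close> negative.\<close>

lemma second_nbr_negative:
  assumes b: "b \<in> V" "card (E `` {b}) \<ge> 3"
    and p: "(b, p) \<in> E" and q: "(b, q) \<in> E" "p \<noteq> q" "card (E `` {p}) \<ge> 2" "card (E `` {q}) = 2"
    and q2: "(q, q2) \<in> E" "q2 \<noteq> b"
    and low: "\<And>z. z \<in> V \<Longrightarrow> z \<noteq> b \<Longrightarrow> card (E `` {z}) \<ge> 2 \<Longrightarrow> x b < x z"
  shows "x q2 < 0"
proof -
  obtain l where l: "l \<in> side E b p" "card (E `` {l}) = 1" using side_has_leaf[OF p] .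
  have lq: "l \<notin> side E b q" using side_unique[OF p q(1) l(1)] q(2) by auto
  have "l \<notin> side E q q2" using side_psubset[OF q(1) q2] lq by auto
  moreover have "l \<noteq> q" using lq in_side_self by auto
  moreover have "l \<in> V" using side_V[OF l(1)] edge_V[OF p] by simp
  ultimately have "x q2 * (x l - x q) > 0 \<or> x q2 = 0 \<and> x l = x q"
    using move_sign[OF q2(1)] l(2) q(4) by auto
  moreover have "x l < x q" by (rule leg_swap[OF b q(1) p q(2)[symmetric] q(3) l low])
  ultimately show ?thesis by (auto simp: zero_less_mult_iff)
qed

text \<open>The tree is the spider with legs of lengths 1, 2, 2, too small for the hub estimate. Its
  equations are solved by symmetry and have only the zero solution for \<open>L > 4\<close>.\<close>

lemma spider_122_impossible:
  assumes V6: "card V = 6" and L4: "L > 4"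
    and b: "b \<in> V" "card (E `` {b}) = 3"
    and p: "(b, p) \<in> E" "card (E `` {p}) = 2" and q: "(b, q) \<in> E" "card (E `` {q}) = 2" "p \<noteq> q"
  shows False
proof -
  have two: "\<exists>s. E `` {t} = {b, s} \<and> s \<noteq> b" if "(b, t) \<in> E" "card (E `` {t}) = 2" for t
  proof -
    obtain y z where yz: "E `` {t} = {y, z}" "y \<noteq> z" using \<open>card (E `` {t}) = 2\<close> by (auto simp: card_2_iff)
    moreover have "b \<in> E `` {t}" using edge_sym[OF that(1)] by simp
    ultimately show ?thesis by auto
  qed
  obtain p2 where p2: "E `` {p} = {b, p2}" "p2 \<noteq> b" using two[OF p] by auto
  obtain q2 where q2: "E `` {q} = {b, q2}" "q2 \<noteq> b" using two[OF q(1,2)] by auto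
  have "card (E `` {b} - {p, q}) = 1" using b p q finite_nbrs[of b] by (simp add: card_Diff_subset)
  then obtain c where c: "E `` {b} - {p, q} = {c}" by (auto simp: card_1_singleton_iff)
  have Nb: "E `` {b} = {c, p, q}" using c p q by auto
  have cb: "(b, c) \<in> E" "c \<noteq> p" "c \<noteq> q" using c by auto
  have e: "(p, p2) \<in> E" "(q, q2) \<in> E" using p2 q2 by auto
  have nb: "c \<noteq> b" "p \<noteq> b" "q \<noteq> b" "p \<noteq> p2" "q \<noteq> q2"
    using edge_neq[OF cb(1)] edge_neq[OF p(1)] edge_neq[OF q(1)] edge_neq[OF e(1)] edge_neq[OF e(2)] by auto
  have sp: "p2 \<in> side E b p" using side_closed[OF in_side_self e(1), of b] nb p2 by simp
  have sq: "q2 \<in> side E b q" using side_closed[OF in_side_self e(2), of b] nb q2 by simp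
  have n2: "p2 \<noteq> q" "p2 \<noteq> c" "q2 \<noteq> p" "q2 \<noteq> c" "p2 \<noteq> q2"
    using nbr_in_side[OF p(1) q(1)] nbr_in_side[OF p(1) cb(1)] nbr_in_side[OF q(1) p(1)]
      nbr_in_side[OF q(1) cb(1)] side_unique[OF p(1) q(1) sp] sp sq q(3) cb by auto
  let ?A = "{b, c, p, q, p2, q2}"
  have A6: "card ?A = 6" using nb n2 p2 q2 cb q by auto
  have AV: "?A \<subseteq> V" using b edge_V(2)[OF cb(1)] edge_V(2)[OF p(1)] edge_V(2)[OF q(1)] edge_V(2)[OF e(1)] edge_V(2)[OF e(2)] by auto
  have VA: "V = ?A" using card_subset_eq[OF finite_V AV] A6 V6 by simp
  have sumV: "sum f V = f b + f c + f p + f q + f p2 + f q2" for f :: "'a \<Rightarrow> 'c::comm_monoid_add"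
    unfolding VA using nb n2 p2 q2 cb q by (simp add: add_ac)
  have "card (E `` {c}) + card (E `` {p2}) + card (E `` {q2}) = 3"
    using sum_deg card_E V6 sumV[of "\<lambda>v. card (E `` {v})"] b p q by simp
  moreover have "card (E `` {c}) \<ge> 1" "card (E `` {p2}) \<ge> 1" "card (E `` {q2}) \<ge> 1"
    using nbrs_ne[OF _ b(1)] AV nb p2 q2 by auto
  ultimately have d1: "card (E `` {c}) = 1" "card (E `` {p2}) = 1" "card (E `` {q2}) = 1" by linarith+
  have single: "E `` {t} = {s}" if "(s, t) \<in> E" "card (E `` {t}) = 1" for s t
    using that edge_sym[OF that(1)] by (metis Image_singleton_iff card_1_singletonE singletonD)
  have N1: "E `` {c} = {b}" "E `` {p2} = {p}" "E `` {q2} = {q}"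
    using single cb(1) e d1 by auto
  define S where "S = sum x V"
  have S: "S = x b + x c + x p + x q + x p2 + x q2" unfolding S_def by (rule sumV)
  have VV: "b \<in> V" "c \<in> V" "p \<in> V" "q \<in> V" "p2 \<in> V" "q2 \<in> V" using AV by auto
  have eb: "L * x b = S - 2 * (x c + x p + x q)"
    using eig[OF VV(1)] Nb cb q by (simp add: S_def add_ac)
  have ec: "L * x c = S - 2 * x b" using eig[OF VV(2)] N1 by (simp add: S_def)
  have ep: "L * x p = S - 2 * (x b + x p2)" using eig[OF VV(3)] p2 by (simp add: S_def)
  have eq: "L * x q = S - 2 * (x b + x q2)" using eig[OF VV(4)] q2 by (simp add: S_def)
  have ep2: "L * x p2 = S - 2 * x p" using eig[OF VV(5)] N1 by (simp add: S_def)
  have eq2: "L * x q2 = S - 2 * x q" using eig[OF VV(6)] N1 by (simp add: S_def)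
  \<comment> \<open>The part of \<open>x\<close> that is antisymmetric under exchange of the two
    long legs would need \<open>L * L = 4\<close>.\<close>
  define D where "D = x p - x q"
  define D2 where "D2 = x p2 - x q2"
  have DD: "L * D = - 2 * D2" "L * D2 = - 2 * D" using ep eq ep2 eq2 by (simp_all add: D_def D2_def algebra_simps)
  have "L * (L * D) = - 2 * (L * D2)" unfolding DD(1) by simp
  then have "L * (L * D) = 4 * D" using DD(2) by simp
  then have "(L * L - 4) * D = 0" by (simp add: algebra_simps)
  moreover have "L * L > 4 * 4" using L4 by (intro mult_strict_mono) auto
  ultimately have D0: "D = 0" by auto
  then have D20: "D2 = 0" using DD by simp
  define M where "M = L - 2"
  have L: "L = M + 2" and M: "M > 2" using L4 by (auto simp: M_def)
  have pq: "x q = x p" "x q2 = x p2" using D0 D20 by (auto simp: D_def D2_def)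
  have m1: "M * x p2 = x b + x c" using ep2 S pq L by (simp add: algebra_simps)
  have m2: "M * x p = x c - x b" using ep S pq L by (simp add: algebra_simps)
  have "(M + 1) * x b = - x c - 2 * x p + 2 * x p2" using eb S pq L by (simp add: algebra_simps)
  then have "M * ((M + 1) * x b) = - (M * x c) - 2 * (M * x p) + 2 * (M * x p2)"
    by (simp only: right_diff_distrib distrib_left; simp)
  then have k1: "(M * M + M - 4) * x b = - (M * x c)" unfolding m1 m2 by (simp add: algebra_simps)
  have "(M + 1) * x c = - x b + 2 * x p + 2 * x p2" using ec S pq L by (simp add: algebra_simps)
  then have "M * ((M + 1) * x c) = - (M * x b) + 2 * (M * x p) + 2 * (M * x p2)"
    by (simp only: right_diff_distrib distrib_left; simp)
  then have k2: "(M * M + M - 4) * x c = - (M * x b)" unfolding m1 m2 by (simp add: algebra_simps)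
  have MM: "M * M > 2 * 2" using M by (intro mult_strict_mono) auto
  \<comment> \<open>The reduced equations \<open>k1\<close> and \<open>k2\<close> are symmetric in
    \<open>b\<close> and \<open>c\<close>, so the sum and the difference of the two values
    decouple.\<close>
  have "(M * M + M - 4) * (x b + x c) = - M * (x b + x c)" using k1 k2 by (simp add: algebra_simps)
  then have "(M * M + M - 4 + M) * (x b + x c) = 0" by (simp add: algebra_simps)
  moreover have "M * M + M - 4 + M \<noteq> 0" using MM M by linarith
  ultimately have s0: "x b + x c = 0" by simp
  have "(M * M + M - 4) * (x b - x c) = M * (x b - x c)" using k1 k2 by (simp add: algebra_simps)
  then have "(M * M - 4) * (x b - x c) = 0" by (simp add: algebra_simps)
  moreover have "M * M - 4 \<noteq> 0" using MM by linarith
  ultimately have s1: "x b - x c = 0" by simp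
  have bc: "x b = 0" "x c = 0" using s0 s1 by auto
  have "x p = 0" "x p2 = 0" using m1 m2 bc M by auto
  then show False using x_ne pq bc unfolding VA by auto
qed

end

section \<open>Exclusion of a second hub\<close>

context extremal_nat_tree
begin

text \<open>Away from the other hub, the lower one \<open>w\<close> has positive neighbours and the
  higher one \<open>v\<close> negative ones. So \<open>hub_bound\<close> applies, the exceptional
  neighbours \<open>cw\<close> and \<open>cv\<close> being those that lead from one hub to the
  other.\<close>

lemma two_branching_impossible:
  assumes n: "6 \<le> n" and kn: "card (leaf_set {..<n} E) + 2 \<le> n"
    and v: "v < n" "card (E `` {v}) \<ge> 3" and w: "w < n" "card (E `` {w}) \<ge> 3" and lt: "x w < x v"
    and rest: "\<And>u. u < n \<Longrightarrow> u \<noteq> v \<Longrightarrow> u \<noteq> w \<Longrightarrow> card (E `` {u}) \<le> 2"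
  shows False
proof -
  define k where "k = card (leaf_set {..<n} E)"
  have vw: "v \<noteq> w" using lt by auto
  have "{u \<in> {..<n}. card (E `` {u}) \<ge> 3} = {v, w}" using v w rest by fastforce
  then have "k = 2 + ((card (E `` {v}) - 2) + (card (E `` {w}) - 2))"
    using card_leaf_set n vw by (simp add: k_def)
  then have k: "card (E `` {v}) + card (E `` {w}) = k + 2" using v w by simp
  obtain cw where cw: "(w, cw) \<in> E" "v \<in> side E w cw" using side_cover[of v w] v w vw by auto
  obtain cv where cv: "(v, cv) \<in> E" "w \<in> side E v cv" using side_cover[of w v] v w vw by auto
  have pos: "x d \<ge> 0" if "(w, d) \<in> E" "d \<noteq> cw" for d
  proof -
    have "v \<notin> side E w d" using side_unique[OF cw(1) that(1) cw(2)] that(2) by auto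
    then have "x d * (x v - x w) > 0" using away_nbr_sign[of w v d] that v w vw by auto
    then show ?thesis using lt by (simp add: zero_less_mult_iff)
  qed
  have neg: "x d < 0 \<and> d \<noteq> w" if "(v, d) \<in> E" "d \<noteq> cv" for d
  proof -
    have d: "w \<notin> side E v d" using side_unique[OF cv(1) that(1) cv(2)] that(2) by auto
    then have "x d * (x w - x v) > 0" using away_nbr_sign[of v w d] that v w vw by auto
    then show ?thesis using lt d in_side_self[of d v] by (auto simp: zero_less_mult_iff)
  qed
  have "card (E `` {v} - {cv}) > 0" using v finite_nbrs[of v] cv(1) by simp
  then obtain u where u: "(v, u) \<in> E" "u \<noteq> cv" by (auto simp: card_gt_0_iff)
  obtain a where a: "a > 0" "sum x {..<n} < 2 * a"
    "L\<^sup>2 * a \<le> 4 * (real (card (E `` {w})) + real (card (E `` {v}))) * a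
       + (2 * L - 2 * real (card (E `` {v})) - 4) * sum x {..<n}"
  proof (rule hub_bound[of w cw v cv u])
    show "x d \<le> 0" if "(v, d) \<in> E" "d \<noteq> cv" for d using neg[OF that] by simp
  qed (use v w vw rest pos neg[OF u] edge_V[OF u(1)] in auto)
  have k4: "4 \<le> k" using k v w by simp
  have B: "4 * (real k + 2) < L\<^sup>2" "4 * (real k - 2) \<le> (L - 2)\<^sup>2"
    using index_bounds(2)[OF refl _ kn n] k4 by (auto simp: k_def)
  have "real (card (E `` {v})) + real (card (E `` {w})) = real k + 2"
    using k by (metis of_nat_add of_nat_numeral)
  \<comment> \<open>This leaves degree at most \<open>k - 1\<close> for \<open>w\<close>, so the
    bound with \<open>k - 2\<close> suffices.\<close>
  moreover have "real (card (E `` {v})) \<ge> 3" using v by simp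
  ultimately show False
    using hub_contradiction[OF a(1) S_nonneg a(2,3)] B by (simp add: algebra_simps)
qed

lemma second_nbr:
  assumes b: "b < n" "\<And>u. u < n \<Longrightarrow> u \<noteq> b \<Longrightarrow> card (E `` {u}) \<le> 2"
    and p: "(b, p) \<in> E" "card (E `` {p}) \<ge> 2"
  obtains p2 where "E `` {p} = {b, p2}" "(p, p2) \<in> E" "p2 \<noteq> b" "p2 \<noteq> p" "p2 \<in> side E b p" "p2 < n"
proof -
  have "card (E `` {p}) = 2" using p b(2)[of p] edge_V[OF p(1)] edge_neq[OF p(1)] by auto
  then obtain y z where yz: "E `` {p} = {y, z}" "y \<noteq> z" by (auto simp: card_2_iff)
  moreover have "b \<in> E `` {p}" using edge_sym[OF p(1)] by simp
  ultimately obtain p2 where p2: "E `` {p} = {b, p2}" "p2 \<noteq> b" by auto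
  then have e: "(p, p2) \<in> E" by auto
  have "p2 \<in> side E b p" using side_closed[OF in_side_self e, of b] edge_neq[OF p(1)] p2 by auto
  then show thesis using that[OF p2(1) e p2(2)] edge_neq[OF e] edge_V[OF e] by auto
qed

text \<open>The second hub is \<open>p\<close>, of degree 2: its only neighbour other than
  \<open>b\<close> is \<open>p2\<close>, which \<open>second_nbr_negative\<close> makes negative.
  The vertex \<open>q2\<close>, negative for the same reason, limits the total sum.\<close>

lemma two_long_legs_positive:
  assumes n: "7 \<le> n" and kn: "card (E `` {b}) + 3 \<le> n"
    and k: "card (leaf_set {..<n} E) = card (E `` {b})"
    and b: "b < n" "card (E `` {b}) \<ge> 3" "\<And>u. u < n \<Longrightarrow> u \<noteq> b \<Longrightarrow> card (E `` {u}) \<le> 2"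
    and p: "(b, p) \<in> E" "card (E `` {p}) \<ge> 2" and q: "(b, q) \<in> E" "card (E `` {q}) \<ge> 2" "p \<noteq> q"
    and low: "\<And>z. z < n \<Longrightarrow> z \<noteq> b \<Longrightarrow> card (E `` {z}) \<ge> 2 \<Longrightarrow> x b < x z"
    and nbr: "\<And>c. (b, c) \<in> E \<Longrightarrow> x c > 0"
    and q2: "(q, q2) \<in> E" "q2 \<noteq> b" and small: "n = 7 \<Longrightarrow> card (E `` {b}) = 3 \<Longrightarrow> card (E `` {q2}) = 1"
  shows False
proof -
  define k where "k = card (E `` {b})"
  have bV: "b \<in> {..<n}" using b by simp
  obtain p2 where p2: "E `` {p} = {b, p2}" "(p, p2) \<in> E" "p2 \<noteq> b" using second_nbr[OF b(1,3) p] .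
  have pd: "card (E `` {p}) = 2" using p2 by simp
  have qd: "card (E `` {q}) = 2"
    using q b(3)[of q] edge_V[OF q(1)] edge_neq[OF q(1)] by auto
  have xq2: "x q2 < 0"
    by (rule second_nbr_negative[OF bV b(2) p(1) q(1,3) p(2) qd q2]) (use low in auto)
  have xp2: "x p2 < 0"
    by (rule second_nbr_negative[OF bV b(2) q(1) p(1) q(3)[symmetric] q(2) pd p2(2,3)]) (use low in auto)
  have pb: "p \<noteq> b" "q \<noteq> b" using edge_neq[OF p(1)] edge_neq[OF q(1)] by auto
  obtain a where a: "a > 0" "sum x {..<n} < 2 * a" "\<And>i. i \<in> {..<n} \<Longrightarrow> i \<noteq> p \<Longrightarrow> 2 * x i \<le> a"
    "L\<^sup>2 * a \<le> 4 * (real (card (E `` {b})) + real (card (E `` {p}))) * a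
       + (2 * L - 2 * real (card (E `` {p})) - 4) * sum x {..<n}"
  proof (rule hub_bound[of b b p b q2])
    show "x d \<le> 0" if "(p, d) \<in> E" "d \<noteq> b" for d
    proof -
      have "d \<in> {b, p2}" unfolding p2(1)[symmetric] using that by simp
      then show ?thesis using that(2) xp2 by auto
    qed
    show "x d \<ge> 0" if "(b, d) \<in> E" for d using nbr[OF that] by simp
  qed (use b p pb edge_V[OF p(1)] edge_V[OF q2(1)] q2 xq2 in auto)
  have a4: "L\<^sup>2 * a \<le> 4 * (real k + 2) * a + (2 * L - 2 * 2 - 4) * sum x {..<n}"
    using a(4) pd by (simp add: k_def)
  have k3: "3 \<le> k" "k + 2 \<le> n" "card (leaf_set {..<n} E) = k" "6 \<le> n" "k + 3 \<le> n"
    using b k kn n by (auto simp: k_def)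
  note I = index_bounds[OF k3(3,1,2,4)]
  show False
  proof (cases "n = 7 \<and> k = 3")
    case False
    show False using hub_contradiction[OF a(1) S_nonneg a(2) a4] I(3,4) k3 n False by auto
  next
    case True
    then have "card (E `` {q2}) = 1" using small by (simp add: k_def)
    then have N: "E `` {q2} = {q}"
      using edge_sym[OF q2(1)] by (metis Image_singleton_iff card_1_singletonE singletonD)
    \<comment> \<open>The equation at the leaf \<open>q2\<close> improves the bound on the sum from
      \<open>2 * a\<close> to \<open>a\<close>, and the estimate becomes
      \<open>(L - 1)^2 <= 13\<close>.\<close>
    have "L * x q2 < 0" using xq2 L_pos by (simp add: mult_less_0_iff)
    then have "sum x {..<n} < 2 * x q" using eig[of q2] edge_V[OF q2(1)] N by simp
    also have "\<dots> \<le> a" using a(3)[of q] q(3) edge_V[OF q(1)] by auto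
    finally have S: "sum x {..<n} \<le> a" by simp
    have "(2 * L - 2 * 2 - 4) * sum x {..<n} \<le> (2 * L - 2 * 2 - 4) * a"
      using S I(1) by (intro mult_left_mono) auto
    with a4 True have "L\<^sup>2 * a \<le> (20 + (2 * L - 2 * 2 - 4)) * a" by (simp add: algebra_simps)
    then have "L\<^sup>2 \<le> 20 + (2 * L - 2 * 2 - 4)" using a(1) by simp
    moreover have "13 < (L - 1)\<^sup>2" using I(5) True by blast
    ultimately show False by (simp add: power2_eq_square algebra_simps)
  qed
qed

text \<open>The value at \<open>b\<close> lies below or above those at all other internal vertices.
  If below, all its neighbours are positive and \<open>p\<close> is the hub with nonpositive ones.
  If above, all are negative, whence \<open>x b >= 0\<close> by the equation at \<open>b\<close>,
  and the two hubs swap roles.\<close>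

lemma two_long_legs_impossible:
  assumes n: "6 \<le> n" and k: "card (leaf_set {..<n} E) = card (E `` {b})"
    and b: "b < n" "card (E `` {b}) \<ge> 3" "\<And>u. u < n \<Longrightarrow> u \<noteq> b \<Longrightarrow> card (E `` {u}) \<le> 2"
    and p: "(b, p) \<in> E" "card (E `` {p}) \<ge> 2" and q: "(b, q) \<in> E" "card (E `` {q}) \<ge> 2" "p \<noteq> q"
  shows False
proof -
  define k where "k = card (E `` {b})"
  have bV: "b \<in> {..<n}" using b by simp
  obtain p2 where p2: "E `` {p} = {b, p2}" "(p, p2) \<in> E" "p2 \<noteq> b" "p2 \<noteq> p" "p2 \<in> side E b p" "p2 < n"
    using second_nbr[OF b(1,3) p] .
  obtain q2 where q2: "E `` {q} = {b, q2}" "(q, q2) \<in> E" "q2 \<noteq> b" "q2 \<noteq> q" "q2 \<in> side E b q" "q2 < n"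
    using second_nbr[OF b(1,3) q(1,2)] .
  have pd: "card (E `` {p}) = 2" "card (E `` {q}) = 2" using p2(1,3) q2(1,3) by auto
  have pV: "p < n" "q < n" "p \<noteq> b" "q \<noteq> b"
    using edge_V[OF p(1)] edge_V[OF q(1)] edge_neq[OF p(1)] edge_neq[OF q(1)] by auto
  have p2N: "(b, p2) \<notin> E" "(b, q2) \<notin> E" "p2 \<noteq> q2"
    using nbr_in_side[OF p(1) _ p2(5)] nbr_in_side[OF q(1) _ q2(5)] side_unique[OF p(1) q(1) p2(5)]
      p2 q2 q(3) by auto
  \<comment> \<open>The three vertices \<open>b\<close>, \<open>p2\<close>, \<open>q2\<close> lie
    outside the \<open>k\<close> neighbours of \<open>b\<close>.\<close>
  have kn: "k + 3 \<le> n"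
  proof -
    have "b \<notin> E `` {b}" using edge_neq[of b b] by auto
    then have "card (insert b (insert p2 (insert q2 (E `` {b})))) = k + 3"
      using p2 q2 p2N finite_nbrs[of b] by (simp add: k_def)
    moreover have "insert b (insert p2 (insert q2 (E `` {b}))) \<subseteq> {..<n}" using b p2 q2 E_sub by auto
    ultimately show ?thesis using card_mono[of "{..<n}"] by (metis card_lessThan finite_lessThan)
  qed
  have kk: "card (leaf_set {..<n} E) = k" "3 \<le> k" "k + 2 \<le> n" using k kn b by (auto simp: k_def)
  note I = index_bounds[OF kk n]
  have n7: "7 \<le> n"
  proof (rule ccontr)
    assume "\<not> 7 \<le> n"
    then have "n = 6" using n by simp
    then have "card {..<n} = 6" "k = 3" using kn kk by auto
    then show False
      using spider_122_impossible[OF _ I(1) bV _ p(1) pd(1) q(1) pd(2) q(3)] by (simp add: k_def)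
  qed
  have nbr: "\<exists>z\<in>{p, q}. x c * (x z - x b) > 0" if c: "(b, c) \<in> E" for c
  proof (cases "c = p")
    case True
    have "q \<notin> side E b c" using nbr_in_side[OF p(1) q(1)] q(3) True by auto
    then show ?thesis using away_nbr_sign[OF bV b(2) _ _ q(2) c] pV by auto
  next
    case False
    have "p \<notin> side E b c" using nbr_in_side[OF c p(1)] False by auto
    then show ?thesis using away_nbr_sign[OF bV b(2) _ _ p(2) c] pV by auto
  qed
  have diff: "x z \<noteq> x b" if "z < n" "z \<noteq> b" "card (E `` {z}) \<ge> 2" for z
    using branching_values_differ[OF bV b(2)] that by auto
  have between: "\<not> (x y < x b \<and> x b < x z)"
    if "y < n" "card (E `` {y}) \<ge> 2" "z < n" "card (E `` {z}) \<ge> 2" for y z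
    using branching_not_between[OF bV b(2)] that by auto
  show False
  proof (cases "x b < x p")
    case True
    then have low: "x b < x z" if "z < n" "z \<noteq> b" "card (E `` {z}) \<ge> 2" for z
      using between[of z p] diff[OF that] that pV p by fastforce
    have pos: "x c > 0" if "(b, c) \<in> E" for c
      using nbr[OF that] low[OF pV(1,3) p(2)] low[OF pV(2,4) q(2)] by (auto simp: zero_less_mult_iff)
    show False
    proof (cases "n = 7 \<and> k = 3 \<and> card (E `` {p2}) \<noteq> 1 \<and> card (E `` {q2}) \<noteq> 1")
      case False
      then have "(n = 7 \<longrightarrow> k = 3 \<longrightarrow> card (E `` {p2}) = 1) \<or> (n = 7 \<longrightarrow> k = 3 \<longrightarrow> card (E `` {q2}) = 1)" by auto
      then show False
      proof
        assume "n = 7 \<longrightarrow> k = 3 \<longrightarrow> card (E `` {p2}) = 1"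
        then show False
          using two_long_legs_positive[OF n7 kn[unfolded k_def] k b q(1,2) p q(3)[symmetric] low pos p2(2,3)] by (auto simp: k_def)
      next
        assume "n = 7 \<longrightarrow> k = 3 \<longrightarrow> card (E `` {q2}) = 1"
        then show False
          using two_long_legs_positive[OF n7 kn[unfolded k_def] k b p q low pos q2(2,3)] by (auto simp: k_def)
      qed
    next
      case True
      \<comment> \<open>If both legs went beyond their second vertex, they would have at least 3
        vertices each and, with \<open>b\<close> and a third branch, make 8.\<close>
      have third: "\<exists>s3. s3 \<in> side E b s \<and> s3 \<noteq> s \<and> s3 \<noteq> s2 \<and> s3 < n"
        if s: "(b, s) \<in> E" "s2 \<in> side E b s" "(s, s2) \<in> E" "(b, s2) \<notin> E" "s2 \<noteq> b" "card (E `` {s2}) \<noteq> 1" for s s2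
      proof -
        have "E `` {s2} \<noteq> {s}" using s(6) by auto
        then obtain s3 where s3: "(s2, s3) \<in> E" "s3 \<noteq> s" using edge_sym[OF s(3)] by auto
        have "s3 \<noteq> b" using edge_sym[OF s3(1)] s(4) by auto
        then have "s3 \<in> side E b s" using side_closed[OF s(2) s3(1)] s(5) by simp
        then show ?thesis using s3 edge_neq[OF s3(1)] edge_V[OF s3(1)] by auto
      qed
      obtain p3 where p3: "p3 \<in> side E b p" "p3 \<noteq> p" "p3 \<noteq> p2" "p3 < n"
        using third[OF p(1) p2(5,2) p2N(1) p2(3)] True by auto
      obtain q3 where q3: "q3 \<in> side E b q" "q3 \<noteq> q" "q3 \<noteq> q2" "q3 < n"
        using third[OF q(1) q2(5,2) p2N(2) q2(3)] True by auto
      obtain c where c: "(b, c) \<in> E" "p \<notin> side E b c" "q \<notin> side E b c"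
        using nbr_avoiding_two[OF b(2) bV _ _ pV(3,4)] pV by auto
      have cpq: "c \<noteq> p" "c \<noteq> q" using c in_side_self by auto
      have disj: "side E b p \<inter> side E b q = {}" "c \<notin> side E b p" "c \<notin> side E b q"
        using side_unique[OF p(1) q(1)] q(3) nbr_in_side[OF p(1) c(1)] nbr_in_side[OF q(1) c(1)] cpq by auto
      have bn: "b \<notin> side E b p" "b \<notin> side E b q" "b \<noteq> c"
        using side_neq[of b b p] side_neq[of b b q] pV edge_neq[OF c(1)] by auto
      let ?P = "{p, p2, p3}" and ?Q = "{q, q2, q3}"
      have PQ: "?P \<subseteq> side E b p" "?Q \<subseteq> side E b q"
        using p2 p3 q2 q3 in_side_self by auto
      have "card (?P \<union> ?Q) = card ?P + card ?Q" using PQ disj by (intro card_Un_disjoint) auto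
      also have "\<dots> = 6" using p2 p3 q2 q3 by auto
      finally have "card (insert b (insert c (?P \<union> ?Q))) = 8"
        using PQ disj bn by (subst card_insert_disjoint; (subst card_insert_disjoint)?) auto
      moreover have "insert b (insert c (?P \<union> ?Q)) \<subseteq> {..<n}"
        using b p2 p3 q2 q3 pV edge_V[OF c(1)] by auto
      ultimately have "8 \<le> n" using card_mono[of "{..<n}"] by (metis card_lessThan finite_lessThan)
      then show False using True by simp
    qed
  next
    case False
    then have pb: "x p < x b" using diff[OF pV(1,3) p(2)] by simp
    then have up: "x z < x b" if "z < n" "z \<noteq> b" "card (E `` {z}) \<ge> 2" for z
      using between[of p z] diff[OF that] that pV p by fastforce
    have neg: "x c < 0" if "(b, c) \<in> E" for c
      using nbr[OF that] up[OF pV(1,3) p(2)] up[OF pV(2,4) q(2)] by (auto simp: zero_less_mult_iff)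
    have "sum x (E `` {b}) \<le> 0" using neg less_imp_le by (intro sum_nonpos) blast
    then have "L * x b \<ge> 0" using eig[OF bV] S_nonneg by linarith
    then have xb: "x b \<ge> 0" using L_pos by (simp add: zero_le_mult_iff)
    obtain a where a: "a > 0" "sum x {..<n} < 2 * a"
      "L\<^sup>2 * a \<le> 4 * (real (card (E `` {p})) + real (card (E `` {b}))) * a
         + (2 * L - 2 * real (card (E `` {b})) - 4) * sum x {..<n}"
    proof (rule hub_bound[of p p2 b b q])
      show "x d \<ge> 0" if "(p, d) \<in> E" "d \<noteq> p2" for d
      proof -
        have "d \<in> {b, p2}" unfolding p2(1)[symmetric] using that by simp
        then show ?thesis using that(2) xb by auto
      qed
      show "x d \<le> 0" if "(b, d) \<in> E" for d using neg[OF that] by simp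
    qed (use b p pV q neg[OF q(1)] in auto)
    \<comment> \<open>Here the first hub is \<open>p\<close>, so \<open>d1 = 2\<close> and the
      second condition only asks for \<open>4 <= (L - 2)^2\<close>.\<close>
    have "2 * 2 \<le> (L - 2) * (L - 2)" using I(1) by (intro mult_mono) auto
    then show False
      using hub_contradiction[OF a(1) S_nonneg a(2,3)] I(3) kn n7 pd
      by (simp add: k_def power2_eq_square algebra_simps)
  qed
qed

text \<open>Branching vertices have distinct values, none between two others, so there are at most
  two; two of them, or one with two long legs, are already excluded. The vertex \<open>c\<close> is
  the only possible start of a long leg.\<close>

lemma extremal_structure:
  assumes n: "6 \<le> n" and kn: "card (leaf_set {..<n} E) + 2 \<le> n"
  obtains b c where "b < n" "card (E `` {b}) = card (leaf_set {..<n} E)"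
    "\<And>u. u < n \<Longrightarrow> u \<noteq> b \<Longrightarrow> card (E `` {u}) \<le> 2"
    "\<And>u. (b, u) \<in> E \<Longrightarrow> u \<noteq> c \<Longrightarrow> card (E `` {u}) = 1"
proof -
  let ?d = "\<lambda>u. card (E `` {u})"
  let ?k = "card (leaf_set {..<n} E)"
  define B where "B = {u \<in> {..<n}. ?d u \<ge> 3}"
  have k: "?k = 2 + (\<Sum>u\<in>B. ?d u - 2)" using card_leaf_set n by (simp add: B_def)
  have B: "u \<in> B \<longleftrightarrow> u < n \<and> ?d u \<ge> 3" for u by (auto simp: B_def)
  have diff: "x u \<noteq> x v" if "u \<in> B" "v \<in> B" "u \<noteq> v" for u v
    using branching_values_differ[of v u] that B by auto
  have mid: "\<not> (x u < x v \<and> x v < x w)" if "u \<in> B" "v \<in> B" "w \<in> B" for u v w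
    using branching_not_between[of v u w] that B by auto
  have two: False if uv: "u \<in> B" "v \<in> B" "x u < x v" for u v
  proof -
    have "w = u \<or> w = v" if "w \<in> B" for w
    proof (rule ccontr)
      assume "\<not> ?thesis"
      then have "x w \<noteq> x u" "x w \<noteq> x v" using diff that uv by auto
      then show False using mid[of w u v] mid[of u w v] mid[of u v w] that uv by linarith
    qed
    then have "?d w \<le> 2" if "w < n" "w \<noteq> v" "w \<noteq> u" for w using B[of w] that by fastforce
    then show False using two_branching_impossible[OF n kn, of v u] uv B by auto
  qed
  have single: "u = v" if "u \<in> B" "v \<in> B" for u v
    using two[of u v] two[of v u] diff[of u v] that by (metis linorder_less_linear)
  have pos: "?d u \<ge> 1" if "u < n" for u
  proof -
    define t where "t = (if u = 0 then 1 else 0 :: nat)"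
    have "t < n" "t \<noteq> u" using n by (auto simp: t_def)
    then show ?thesis using nbrs_ne[of u t] that by auto
  qed
  show thesis
  proof (cases "B = {}")
    \<comment> \<open>The tree is a path; the neighbour of one end acts as hub of degree
      \<open>k = 2\<close>.\<close>
    case True
    then have k2: "?k = 2" using k by simp
    then have "leaf_set {..<n} E \<noteq> {}" by (metis card.empty zero_neq_numeral)
    then obtain l where l: "l < n" "?d l = 1" by (auto simp: leaf_set_def)
    then obtain b where b: "E `` {l} = {b}" by (auto simp: card_1_singleton_iff)
    have lb: "(l, b) \<in> E" using b by auto
    have le2: "?d u \<le> 2" if "u < n" for u using True B[of u] that by auto
    have "\<exists>t. t < n \<and> t \<noteq> l \<and> t \<noteq> b"
    proof -
      have "\<not> {..<n} \<subseteq> {l, b}" using n card_mono[of "{l, b}" "{..<n}"] by (auto simp: card_insert_if split: if_splits)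
      then show ?thesis by auto
    qed
    then obtain t where t: "t < n" "t \<noteq> l" "t \<noteq> b" by blast
    have bn: "b < n" using edge_V[OF lb] by simp
    have b2: "?d b = 2" using leaf_nbr_internal[OF lb l(2) _ t(2,3)] t(1) le2[OF bn] by auto
    then obtain y z where "E `` {b} = {y, z}" by (auto simp: card_2_iff)
    moreover have "l \<in> E `` {b}" using edge_sym[OF lb] by simp
    ultimately obtain c where c: "E `` {b} = {l, c}" by auto
    show thesis
    proof (rule that[of b c])
      show "?d u = 1" if "(b, u) \<in> E" "u \<noteq> c" for u
      proof -
        have "u \<in> {l, c}" unfolding c[symmetric] using that by simp
        then show ?thesis using that(2) l by auto
      qed
    qed (use bn b2 k2 le2 in auto)
  next
    case False
    then obtain b where "b \<in> B" by auto
    then have Bb: "B = {b}" using single by auto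
    have b: "b < n" "?d b \<ge> 3" using \<open>b \<in> B\<close> B by auto
    have kb: "?k = ?d b" using k Bb b by simp
    have rest: "?d u \<le> 2" if "u < n" "u \<noteq> b" for u using B[of u] Bb that by auto
    have "\<exists>c. \<forall>u. (b, u) \<in> E \<longrightarrow> u \<noteq> c \<longrightarrow> ?d u = 1"
    proof (rule ccontr)
      assume a: "\<not> ?thesis"
      then obtain p where p: "(b, p) \<in> E" "?d p \<noteq> 1" by blast
      from a obtain q where q: "(b, q) \<in> E" "q \<noteq> p" "?d q \<noteq> 1" by blast
      have "?d p \<ge> 2" "?d q \<ge> 2" using p q pos[of p] pos[of q] edge_V[OF p(1)] edge_V[OF q(1)] by auto
      then show False using two_long_legs_impossible[OF n kb b rest p(1) _ q(1) _ q(2)[symmetric]] by auto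
    qed
    then obtain c where "\<And>u. (b, u) \<in> E \<Longrightarrow> u \<noteq> c \<Longrightarrow> ?d u = 1" by blast
    then show thesis using that[of b c] b kb rest by auto
  qed
qed

end

section \<open>Recognizing a broom by distances from its hub\<close>

context rel_tree
begin

lemma rdist_self: "rdist E b b = 0"
  using rdist_le[where m = 0] by fastforce

lemma rdist_pos:
  assumes "b \<in> V" "v \<in> V" "v \<noteq> b"
  shows "rdist E b v \<ge> 1"
proof (rule ccontr)
  assume "\<not> ?thesis"
  then have "rdist E b v = 0" by simp
  then have "(b, v) \<in> E ^^ 0" using relpow_rdist[OF conn[OF assms(1,2)]] by simp
  then show False using assms(3) by simp
qed

lemma rdist_nbr:
  assumes "(b, v) \<in> E"
  shows "rdist E b v = 1"
  using rdist_edge[OF _ assms, of b] rdist_self[of b] rdist_pos[OF edge_V[OF assms]] edge_neq[OF assms] by auto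

text \<open>Two vertices at the same distance have, by induction, the same predecessor; it would be
  adjacent to both and to its own predecessor, which is one neighbour too many.\<close>

lemma rdist_inj_on_path_side:
  assumes c: "(b, c) \<in> E" and deg: "\<And>u. u \<in> V \<Longrightarrow> u \<noteq> b \<Longrightarrow> card (E `` {u}) \<le> 2"
  shows "inj_on (rdist E b) (side E b c)"
proof -
  let ?d = "rdist E b" and ?R = "side E b c"
  have bV: "b \<in> V" and cV: "c \<in> V" using edge_V[OF c] by auto
  have RV: "u \<in> V \<and> u \<noteq> b" if "u \<in> ?R" for u
    using side_V[OF that cV] side_neq[OF that] edge_neq[OF c] by auto
  have parent: "\<exists>w. (u, w) \<in> E \<and> ?d u = Suc (?d w) \<and> (w = b \<and> u = c \<or> w \<in> ?R)" if u: "u \<in> ?R" for u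
  proof -
    obtain w where w: "(w, u) \<in> E" "?d u = Suc (?d w)"
      using rdist_parent[OF conn[OF bV] , of u] RV[OF u] by blast
    have "w = b \<and> u = c \<or> w \<in> ?R"
      using nbr_in_side[OF c _ u] w(1) side_closed[OF u edge_sym[OF w(1)]] RV[OF u] by (cases "w = b") auto
    then show ?thesis using w edge_sym[OF w(1)] by blast
  qed
  have "u = v" if "u \<in> ?R" "v \<in> ?R" "?d u = m" "?d v = m" for u v m
    using that
  proof (induction m arbitrary: u v)
    case 0
    then show ?case using rdist_pos[OF bV] RV[of u] by fastforce
  next
    case (Suc m)
    obtain u' where u': "(u, u') \<in> E" "?d u = Suc (?d u')" "u' = b \<and> u = c \<or> u' \<in> ?R" using parent Suc.prems(1) by blast
    obtain v' where v': "(v, v') \<in> E" "?d v = Suc (?d v')" "v' = b \<and> v = c \<or> v' \<in> ?R" using parent Suc.prems(2) by blast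
    show ?case
    proof (cases "m = 0")
      case True
      then have "u' \<notin> ?R" "v' \<notin> ?R"
        using u'(2) v'(2) Suc.prems rdist_pos[OF bV] RV[of u'] RV[of v'] by fastforce+
      then show ?thesis using u' v' by simp
    next
      case False
      then have "u' \<noteq> b" "v' \<noteq> b" using u'(2) v'(2) Suc.prems rdist_self[of b] by auto
      then have R: "u' \<in> ?R" "v' \<in> ?R" using u' v' by auto
      then have eq: "v' = u'" using Suc.IH[of v' u'] u'(2) v'(2) Suc.prems by simp
      obtain t where t: "(u', t) \<in> E" "?d u' = Suc (?d t)" using parent R(1) by blast
      have ne: "t \<noteq> u" "t \<noteq> v" using t(2) u'(2) Suc.prems by auto
      have sub: "{t, u, v} \<subseteq> E `` {u'}" using t(1) edge_sym[OF u'(1)] edge_sym[OF v'(1)] eq by auto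
      show ?thesis
      proof (rule ccontr)
        assume "u \<noteq> v"
        then have "card {t, u, v} = 3" using ne by simp
        then show False using card_mono[OF finite_nbrs sub] deg[of u'] RV[OF R(1)] by simp
      qed
    qed
  qed
  then show ?thesis by (auto intro: inj_onI)
qed

text \<open>Predecessors remain in the branch until \<open>b\<close> is reached, so no distance
  below the largest is skipped; injectivity identifies the largest with the size of the
  branch.\<close>

lemma rdist_image_path_side:
  assumes c: "(b, c) \<in> E" and deg: "\<And>u. u \<in> V \<Longrightarrow> u \<noteq> b \<Longrightarrow> card (E `` {u}) \<le> 2"
  shows "rdist E b ` side E b c = {1..card (side E b c)}"
proof -
  let ?d = "rdist E b" and ?R = "side E b c"
  have bV: "b \<in> V" and cV: "c \<in> V" using edge_V[OF c] by auto
  have RV: "u \<in> V \<and> u \<noteq> b" if "u \<in> ?R" for u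
    using side_V[OF that cV] side_neq[OF that] edge_neq[OF c] by auto
  have finR: "finite ?R" using RV finite_V by (meson finite_subset subsetI)
  define M where "M = Max (?d ` ?R)"
  have MD: "M \<in> ?d ` ?R" unfolding M_def using finR in_side_self by (intro Max_in) auto
  have down: "M - j \<in> ?d ` ?R" if "j < M" for j
    using that
  proof (induction j)
    case (Suc j)
    then obtain u where u: "u \<in> ?R" "M - j = ?d u" by auto
    obtain w where w: "(w, u) \<in> E" "?d u = Suc (?d w)"
      using rdist_parent[OF conn[OF bV], of u] RV[OF u(1)] by blast
    have "w \<noteq> b" using w(2) u(2) Suc.prems rdist_self[of b] by auto
    then have "w \<in> ?R" using side_closed[OF u(1) edge_sym[OF w(1)]] RV[OF u(1)] by simp
    moreover have "M - Suc j = ?d w" using w(2) u(2) by simp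
    ultimately show ?case by blast
  qed (use MD in simp)
  have "?d ` ?R = {1..M}"
  proof
    show "?d ` ?R \<subseteq> {1..M}" using rdist_pos[OF bV] RV finR by (auto simp: M_def)
    show "{1..M} \<subseteq> ?d ` ?R"
    proof
      fix i assume "i \<in> {1..M}"
      then show "i \<in> ?d ` ?R" using down[of "M - i"] by auto
    qed
  qed
  moreover have "card (?d ` ?R) = card ?R" by (rule card_image[OF rdist_inj_on_path_side[OF c deg]])
  ultimately show ?thesis by simp
qed

lemma broom_shape:
  assumes b: "b \<in> V" "card (E `` {b}) = k" and k: "k + 2 \<le> card V"
    and deg: "\<And>u. u \<in> V \<Longrightarrow> u \<noteq> b \<Longrightarrow> card (E `` {u}) \<le> 2"
    and leaf: "\<And>u. (b, u) \<in> E \<Longrightarrow> u \<noteq> c \<Longrightarrow> card (E `` {u}) = 1"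
  obtains f where "bij_betw f V {..<card V}"
    "\<And>u v. u \<in> V \<Longrightarrow> v \<in> V \<Longrightarrow> (u, v) \<in> E \<longleftrightarrow> (f u, f v) \<in> broom (card V) k"
proof -
  let ?d = "rdist E b" and ?R = "side E b c" and ?n = "card V"
  have V_eq: "V = insert b (\<Union>u\<in>E `` {b}. side E b u)"
  proof
    show "V \<subseteq> insert b (\<Union>u\<in>E `` {b}. side E b u)"
    proof
      fix u assume u: "u \<in> V"
      show "u \<in> insert b (\<Union>u\<in>E `` {b}. side E b u)"
      proof (cases "u = b")
        case False
        then obtain d where "(b, d) \<in> E" "u \<in> side E b d" using side_cover[OF u b(1)] by blast
        then show ?thesis by auto
      qed simp
    qed
    show "insert b (\<Union>u\<in>E `` {b}. side E b u) \<subseteq> V" using b(1) side_V edge_V(2) by auto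
  qed
  have leaf_sd: "side E b u = {u}" if "(b, u) \<in> E" "u \<noteq> c" for u using leaf_side leaf that by blast
  \<comment> \<open>Otherwise the tree is a star with only \<open>k + 1\<close> vertices.\<close>
  have c: "(b, c) \<in> E"
  proof (rule ccontr)
    assume "(b, c) \<notin> E"
    then have "side E b u = {u}" if "u \<in> E `` {b}" for u using leaf_sd[of u] that by auto
    then have "V = insert b (E `` {b})" using V_eq by simp
    moreover have "card (insert b (E `` {b})) \<le> Suc k" using b(2) finite_nbrs by (simp add: card_insert_if)
    ultimately show False using k by simp
  qed
  have cV: "c \<in> V" using edge_V[OF c] by simp
  have RV: "u \<in> V \<and> u \<noteq> b" if "u \<in> ?R" for u
    using side_V[OF that cV] side_neq[OF that] edge_neq[OF c] by auto
  have finR: "finite ?R" using RV finite_V by (meson finite_subset subsetI)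
  define N where "N = E `` {b} - {c}"
  have finN: "finite N" using finite_nbrs by (simp add: N_def)
  have cardN: "card N = k - 1" and k1: "k \<ge> 1"
    using b(2) c finite_nbrs[of b] card_gt_0_iff[of "E `` {b}"] by (auto simp: N_def)
  have VR: "V = insert b (N \<union> ?R)"
  proof -
    have "E `` {b} = insert c N" using c by (auto simp: N_def)
    moreover have "(\<Union>u\<in>N. side E b u) = N" using leaf_sd by (auto simp: N_def)
    ultimately show ?thesis using V_eq by auto
  qed
  have NR: "N \<inter> ?R = {}" "b \<notin> N" "b \<notin> ?R"
    using nbr_in_side[OF c] RV edge_neq[of b b] by (auto simp: N_def)
  have nR: "?n = k + card ?R"
    unfolding VR using finN finR NR cardN k1 by (simp add: card_Un_disjoint)
  obtain h where h: "bij_betw h N {1..<k}"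
    using finite_same_card_bij[OF finN, of "{1..<k}"] cardN by auto
  \<comment> \<open>The offset \<open>k - 1\<close> sends \<open>c\<close>, at distance 1, to
    \<open>k\<close>, the start of the tail.\<close>
  define f where "f u = (if u = b then 0 else if u \<in> N then h u else k - 1 + ?d u)" for u
  have fb: "f b = 0" by (simp add: f_def)
  have fN: "f u = h u" "1 \<le> h u" "h u < k" if "u \<in> N" for u
    using that NR h by (auto simp: f_def bij_betw_def)
  have fR: "f u = k - 1 + ?d u" "1 \<le> ?d u" "?d u \<le> card ?R" if "u \<in> ?R" for u
  proof -
    show "f u = k - 1 + ?d u" using that NR by (auto simp: f_def)
    have "?d u \<in> {1..card ?R}" using rdist_image_path_side[OF c deg] that by blast
    then show "1 \<le> ?d u" "?d u \<le> card ?R" by auto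
  qed
  have dinj: "inj_on ?d ?R" by (rule rdist_inj_on_path_side[OF c deg])
  have hinj: "inj_on h N" using h by (simp add: bij_betw_def)
  have inj: "inj_on f V"
  proof (rule inj_onI)
    fix u v assume uv: "u \<in> V" "v \<in> V" "f u = f v"
    consider "u = b" | "u \<in> N" | "u \<in> ?R" using uv(1) VR by blast
    then show "u = v"
    proof cases
      case 1
      then show ?thesis using uv(3) fb fN[of v] fR[of v] k1 uv(2) VR by fastforce
    next
      case 2
      consider "v = b" | "v \<in> N" | "v \<in> ?R" using uv(2) VR by blast
      then show ?thesis
        using uv(3) fN[OF 2] fN[of v] fR[of v] fb inj_onD[OF hinj _ 2, of v] by cases auto
    next
      case 3
      consider "v = b" | "v \<in> N" | "v \<in> ?R" using uv(2) VR by blast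
      then show ?thesis
        using uv(3) fR[OF 3] fN[of v] fR[of v] fb inj_onD[OF dinj _ 3, of v] k1 by cases auto
    qed
  qed
  have range: "f ` V \<subseteq> {..<?n}"
  proof
    fix i assume "i \<in> f ` V"
    then obtain u where u: "u \<in> V" "i = f u" by auto
    consider "u = b" | "u \<in> N" | "u \<in> ?R" using u(1) VR by blast
    then show "i \<in> {..<?n}" using u(2) fb fN[of u] fR[of u] nR k1 by cases auto
  qed
  have bij: "bij_betw f V {..<?n}"
    using inj card_subset_eq[OF _ range] card_image[OF inj] by (auto simp: bij_betw_def)
  have bsym: "(i, j) \<in> broom ?n k \<Longrightarrow> (j, i) \<in> broom ?n k" for i j by (auto simp: broom_iff)
  have b_edge: "(f b, f v) \<in> broom ?n k" if "(b, v) \<in> E" for v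
  proof (cases "v = c")
    case True
    then have "f v = k" using fR(1)[OF in_side_self] rdist_nbr[OF c] k1 by simp
    then show ?thesis using k k1 by (simp add: fb broom_iff broom_parent_def)
  next
    case False
    then have "v \<in> N" using that by (simp add: N_def)
    then show ?thesis using fN[of v] k by (auto simp: fb broom_iff broom_parent_def)
  qed
  have up: "(f u, f v) \<in> broom ?n k" if "u \<in> ?R" "v \<in> ?R" "?d v = Suc (?d u)" for u v
    using fR[OF that(1)] fR[OF that(2)] that(3) nR k1 by (auto simp: broom_iff broom_parent_def)
  have edge: "(f u, f v) \<in> broom ?n k" if e: "(u, v) \<in> E" for u v
  proof -
    have uv: "u \<in> V" "v \<in> V" using edge_V[OF e] by auto
    consider "u = b" | "v = b" | "u \<noteq> b" "v \<noteq> b" "u \<in> N \<or> v \<in> N" | "u \<in> ?R" "v \<in> ?R"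
      using uv VR by blast
    then show ?thesis
    proof cases
      case 1
      then show ?thesis using b_edge e by simp
    next
      case 2
      then show ?thesis using bsym[OF b_edge[of u]] edge_sym[OF e] by simp
    next
      case 3
      have "t = b" if "s \<in> N" "(s, t) \<in> E" for s t
      proof -
        have s: "(b, s) \<in> E" "card (E `` {s}) = 1" using that(1) leaf by (auto simp: N_def)
        then show ?thesis
          using edge_sym[OF s(1)] that(2) by (metis Image_singleton_iff card_1_singletonE singletonD)
      qed
      then show ?thesis using 3 e edge_sym[OF e] by blast
    next
      case 4
      have "?d v \<le> Suc (?d u)" "?d u \<le> Suc (?d v)"
        using rdist_edge[OF conn[OF b(1) uv(1)] e] rdist_edge[OF conn[OF b(1) uv(2)] edge_sym[OF e]] by auto
      moreover have "?d u \<noteq> ?d v" using inj_onD[OF dinj _ 4] edge_neq[OF e] by auto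
      ultimately have "?d v = Suc (?d u) \<or> ?d u = Suc (?d v)" by linarith
      then show ?thesis using up[OF 4] bsym[OF up[OF 4(2,1)]] by blast
    qed
  qed
  \<comment> \<open>Preservation of edges is enough: both trees have the same number of pairs, so
    the injective image is everything.\<close>
  have im: "map_prod f f ` E = broom ?n k"
  proof (rule card_subset_eq)
    interpret B: rel_tree "{..<?n}" "broom ?n k"
      using k by (intro rel_tree_parent_rel broom_parent_less) auto
    show "finite (broom ?n k)" by (rule B.finite_E)
    show "map_prod f f ` E \<subseteq> broom ?n k" using edge by auto
    have "inj_on (map_prod f f) E"
      using inj_on_subset[OF map_prod_inj_on[OF inj inj] E_sub] .
    then show "card (map_prod f f ` E) = card (broom ?n k)"
      using B.card_E card_E by (simp add: card_image)
  qed
  show thesis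
  proof (rule that[OF bij])
    fix u v assume uv: "u \<in> V" "v \<in> V"
    show "(u, v) \<in> E \<longleftrightarrow> (f u, f v) \<in> broom ?n k"
    proof
      assume "(f u, f v) \<in> broom ?n k"
      then obtain s t where st: "(s, t) \<in> E" "f u = f s" "f v = f t" unfolding im[symmetric] by auto
      then show "(u, v) \<in> E" using inj_onD[OF inj] uv edge_V[OF st(1)] by metis
    qed (rule edge)
  qed
qed

end

section \<open>Signed complete graphs\<close>

definition adj :: "'a ugraph \<Rightarrow> ('a \<times> 'a) set" where
  "adj T = {(u, v). {u, v} \<in> edges T}"

definition graph_of :: "nat \<Rightarrow> (nat \<times> nat) set \<Rightarrow> nat ugraph" where
  "graph_of n F = ({0..<n}, (\<lambda>(u, v). {u, v}) ` F)"

lemma successively_rtrancl: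
  assumes "p \<noteq> []" "successively (\<lambda>u v. (u, v) \<in> R) p"
  shows "(hd p, last p) \<in> R\<^sup>*"
  using assms
proof (induction p rule: induct_list012)
  case (3 a b p)
  then have "(b, last (b # p)) \<in> R\<^sup>*" "(a, b) \<in> R" by auto
  then show ?case by (simp add: converse_rtrancl_into_rtrancl)
qed auto

text \<open>When a step returns to a vertex of the path, the path is cut back to that
  vertex.\<close>

lemma rtrancl_distinct_path:
  assumes "(a, b) \<in> R\<^sup>*" "a \<in> V" "R \<subseteq> V \<times> V"
  obtains p where "p \<noteq> []" "distinct p" "set p \<subseteq> V" "successively (\<lambda>u v. (u, v) \<in> R) p" "hd p = a" "last p = b"
proof -
  have "\<exists>p. p \<noteq> [] \<and> distinct p \<and> set p \<subseteq> V \<and> successively (\<lambda>u v. (u, v) \<in> R) p \<and> hd p = a \<and> last p = b"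
    using assms(1)
  proof (induction rule: rtrancl_induct)
    case base
    then show ?case using assms(2) by (intro exI[of _ "[a]"]) auto
  next
    case (step b c)
    then obtain p where p: "p \<noteq> []" "distinct p" "set p \<subseteq> V" "successively (\<lambda>u v. (u, v) \<in> R) p"
      "hd p = a" "last p = b" by blast
    show ?case
    proof (cases "c \<in> set p")
      case True
      then obtain ys zs where "p = ys @ c # zs" by (meson split_list)
      then show ?thesis using p
        by (intro exI[of _ "ys @ [c]"]) (auto simp: successively_append_iff successively_Cons hd_append)
    next
      case False
      then show ?thesis using p step.hyps(2) assms(3)
        by (intro exI[of _ "p @ [c]"]) (auto simp: successively_append_iff)
    qed
  qed
  then show thesis using that by blast
qed

text \<open>An edge outside the breadth-first relation \<open>P\<close> would close a path of
  \<open>P\<close> into a cycle, so acyclicity leaves exactly the pairs of \<open>P\<close>.\<close>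

lemma rel_tree_adj:
  assumes T: "spanning_tree T (complete_graph n)"
  shows "rel_tree {..<n} (adj T)"
proof -
  let ?E = "adj T"
  have vT: "verts T = {..<n}" using T by (auto simp: spanning_tree_def complete_graph_def)
  have ed: "e \<subseteq> {..<n} \<and> card e = 2" if "e \<in> edges T" for e
    using T that unfolding spanning_tree_def complete_graph_def lessThan_atLeast0 by auto
  have conT: "connected_graph T" and acyc: "\<nexists>c. cycle T c" using T by (auto simp: spanning_tree_def tree_def)
  have sub: "?E \<subseteq> {..<n} \<times> {..<n}" using ed by (fastforce simp: adj_def)
  have sy: "sym ?E" by (auto simp: adj_def sym_def insert_commute)
  have irr: "irrefl ?E" using ed by (fastforce simp: adj_def irrefl_def)
  have ne: "{..<n} \<noteq> {}" using conT vT by (simp add: connected_graph_def)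
  have con: "(u, v) \<in> ?E\<^sup>*" if uv: "u < n" "v < n" for u v
  proof -
    obtain p where p: "walk T p" "hd p = u" "last p = v"
      using conT uv vT unfolding connected_graph_def by (metis lessThan_iff)
    then show ?thesis using successively_rtrancl[of p ?E] by (auto simp: walk_def adj_def)
  qed
  obtain r where r: "r \<in> {..<n}" using ne by blast
  obtain P where P: "P \<subseteq> ?E" "sym P" "\<And>u v. u \<in> {..<n} \<Longrightarrow> v \<in> {..<n} \<Longrightarrow> (u, v) \<in> P\<^sup>*"
    "card P + 2 = 2 * card {..<n}"
    using connected_spanning_subrelation[OF finite_lessThan r sub _ sy] con r by (metis lessThan_iff)
  have "?E \<subseteq> P"
  proof
    fix e assume e: "e \<in> ?E"
    obtain a b where ab: "e = (a, b)" by (cases e)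
    show "e \<in> P"
    proof (rule ccontr)
      assume nP: "e \<notin> P"
      have abn: "a \<in> {..<n}" "b \<in> {..<n}" using sub e ab by auto
      have PV: "P \<subseteq> {..<n} \<times> {..<n}" using P(1) sub by blast
      obtain p where p: "p \<noteq> []" "distinct p" "set p \<subseteq> {..<n}" "successively (\<lambda>u v. (u, v) \<in> P) p"
        "hd p = a" "last p = b"
        using rtrancl_distinct_path[OF P(3)[OF abn] abn(1) PV] .
      have ab': "a \<noteq> b" using irr e ab by (auto simp: irrefl_def)
      have "length p \<ge> 3"
      proof (rule ccontr)
        assume "\<not> 3 \<le> length p"
        then consider s where "p = [s]" | s t where "p = [s, t]"
          using p(1) by (cases p; cases "tl p"; cases "tl (tl p)") auto
        then show False using p ab' nP ab by cases auto
      qed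
      moreover have "walk T p"
        unfolding walk_def
      proof (intro conjI)
        show "successively (\<lambda>u v. {u, v} \<in> edges T) p"
          using p(4) by (rule successively_mono) (use P(1) in \<open>auto simp: adj_def\<close>)
      qed (use p vT in auto)
      moreover have "{last p, hd p} \<in> edges T"
        using e ab p by (simp add: adj_def insert_commute)
      ultimately have "cycle T p" using p(2) by (simp add: cycle_def)
      then show False using acyc by blast
    qed
  qed
  then have "?E = P" using P(1) by simp
  then show ?thesis using P(4) sub sy irr con ne by unfold_locales auto
qed

lemma adj_graph_of:
  assumes "sym F"
  shows "adj (graph_of n F) = F"
proof -
  have "(u, v) \<in> F" if "{u, v} = {s, t}" "(s, t) \<in> F" for u v s t
    using that symD[OF assms that(2)] by (auto simp: doubleton_eq_iff)
  then show ?thesis unfolding adj_def graph_of_def by (auto simp: image_iff split: prod.splits)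
qed

text \<open>For acyclicity: the rest of a cycle joins the ends of its closing edge, contrary to
  \<open>bridge\<close>.\<close>

lemma spanning_tree_graph_of:
  assumes "rel_tree {..<n} F"
  shows "spanning_tree (graph_of n F) (complete_graph n)"
proof -
  interpret rel_tree "{..<n}" F by (rule assms)
  let ?T = "graph_of n F"
  have ed: "{u, v} \<in> edges ?T \<longleftrightarrow> (u, v) \<in> F" for u v
    using adj_graph_of[OF sym_E, of n] by (auto simp: adj_def)
  have e2: "e \<subseteq> {0..<n} \<and> card e = 2" if "e \<in> edges ?T" for e
  proof -
    obtain u v where "e = {u, v}" "(u, v) \<in> F" using \<open>e \<in> edges ?T\<close> by (auto simp: graph_of_def)
    then show ?thesis using edge_V[of u v] edge_neq[of u v] by auto
  qed
  have "connected_graph ?T"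
    unfolding connected_graph_def
  proof (intro conjI ballI)
    show "verts ?T \<noteq> {}" using V_ne by (auto simp: graph_of_def)
    fix u v assume "u \<in> verts ?T" "v \<in> verts ?T"
    then have uv: "u \<in> {..<n}" "v \<in> {..<n}" by (auto simp: graph_of_def)
    obtain p where p: "p \<noteq> []" "set p \<subseteq> {..<n}" "successively (\<lambda>u v. (u, v) \<in> F) p" "hd p = u" "last p = v"
      using rtrancl_distinct_path[OF conn[OF uv] uv(1) E_sub] .
    then have "walk ?T p" by (auto simp: walk_def ed) (auto simp: graph_of_def)
    then show "\<exists>p. walk ?T p \<and> hd p = u \<and> last p = v" using p by blast
  qed
  moreover have "\<not> cycle ?T c" for c
  proof
    assume c: "cycle ?T c"
    then obtain a d where ad: "c = a # d" by (cases c) (auto simp: cycle_def)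
    have d: "length d \<ge> 2" "distinct d" "a \<notin> set d" "successively (\<lambda>u v. (u, v) \<in> F) (a # d)" "(a, last d) \<in> F"
      using c ad edge_sym[of "last d" a] by (auto simp: cycle_def walk_def ed split: if_splits)
    let ?G = "F - {(a, last d), (last d, a)}"
    have dn: "d \<noteq> []" using d(1) by auto
    have "hd d \<noteq> last d" using d(1,2) by (cases d) (auto split: if_splits)
    moreover have s: "(a, hd d) \<in> F" "successively (\<lambda>u v. (u, v) \<in> F) d"
      using d(4) dn by (auto simp: successively_Cons)
    moreover have "a \<noteq> hd d" using d(3) dn by auto
    ultimately have 1: "(a, hd d) \<in> ?G" by auto
    have "successively (\<lambda>u v. (u, v) \<in> ?G) d"
      using s(2) by (rule successively_mono) (use d(3) in auto)
    from successively_rtrancl[OF dn this] 1 have "(a, last d) \<in> ?G\<^sup>*"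
      by (meson converse_rtrancl_into_rtrancl)
    then show False using bridge[OF d(5)] by simp
  qed
  ultimately show ?thesis
    using e2 by (auto simp: spanning_tree_def tree_def simple_graph_def graph_of_def complete_graph_def)
qed

section \<open>Leaves and balance\<close>

lemma vertex_degree_adj:
  assumes "simple_graph T"
  shows "vertex_degree T v = card (adj T `` {v})"
proof -
  have "{e \<in> edges T. v \<in> e} = (\<lambda>u. {v, u}) ` (adj T `` {v})"
  proof
    show "{e \<in> edges T. v \<in> e} \<subseteq> (\<lambda>u. {v, u}) ` (adj T `` {v})"
    proof
      fix e assume "e \<in> {e \<in> edges T. v \<in> e}"
      then have e: "e \<in> edges T" "v \<in> e" "card e = 2" using assms by (auto simp: simple_graph_def)
      then obtain u where "e = {v, u}" by (auto simp: card_2_iff)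
      then show "e \<in> (\<lambda>u. {v, u}) ` (adj T `` {v})" using e by (auto simp: adj_def)
    qed
  qed (auto simp: adj_def)
  moreover have "inj_on (\<lambda>u. {v, u}) (adj T `` {v})"
    by (auto simp: inj_on_def doubleton_eq_iff)
  ultimately show ?thesis by (simp add: vertex_degree_def card_image)
qed

lemma pendant_vertices_adj:
  assumes "spanning_tree T (complete_graph n)"
  shows "pendant_vertices T = leaf_set {..<n} (adj T)"
proof -
  have "simple_graph T" "verts T = {..<n}"
    using assms by (auto simp: spanning_tree_def tree_def complete_graph_def)
  then show ?thesis by (simp add: pendant_vertices_def leaf_set_def vertex_degree_adj)
qed

text \<open>Two internal vertices give a path \<open>a\<close>, \<open>b\<close>, \<open>c\<close>,
  \<open>d\<close> in the tree, and the triangle on \<open>a\<close>, \<open>b\<close>,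
  \<open>d\<close> has exactly one negative edge, the one between \<open>a\<close> and
  \<open>b\<close>.\<close>

lemma unbalanced_if_two_internal:
  assumes T: "spanning_tree T (complete_graph n)" and k: "card (pendant_vertices T) + 2 \<le> n"
  shows "unbalanced (signed_complete n T)"
proof -
  interpret rel_tree "{..<n}" "adj T" by (rule rel_tree_adj[OF T])
  let ?E = "adj T"
  let ?I = "{..<n} - leaf_set {..<n} ?E"
  have "card ?I = n - card (leaf_set {..<n} ?E)"
    by (subst card_Diff_subset) (auto simp: leaf_set_def)
  then have "2 \<le> card ?I" using k by (simp add: pendant_vertices_adj[OF T])
  then obtain b z where "b \<in> ?I" "z \<in> ?I" "z \<noteq> b" by (auto simp: numeral_2_eq_2 card_le_Suc_iff)
  then have b: "b < n" "card (?E `` {b}) \<noteq> 1" and z: "z < n" "card (?E `` {z}) \<noteq> 1" "z \<noteq> b"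
    by (auto simp: leaf_set_def)
  obtain c where c: "(b, c) \<in> ?E" "z \<in> side ?E b c" using side_cover[of z b] b z by auto
  have "?E `` {b} \<noteq> {c}" using b(2) by auto
  then obtain a where a: "(b, a) \<in> ?E" "a \<noteq> c" using c(1) by auto
  have "card (?E `` {c}) \<noteq> 1" using leaf_side[OF c(1)] c(2) z(2) by auto
  then have "?E `` {c} \<noteq> {b}" by auto
  then obtain d where d: "(c, d) \<in> ?E" "d \<noteq> b" using edge_sym[OF c(1)] by auto
  have cb: "c \<noteq> b" "a \<noteq> b" "c \<noteq> d" using edge_neq[OF c(1)] edge_neq[OF a(1)] edge_neq[OF d(1)] by auto
  have ds: "d \<in> side ?E b c" by (rule side_closed[OF in_side_self d(1) cb(1) d(2)])
  have as: "a \<notin> side ?E b c" using nbr_in_side[OF c(1) a(1)] a(2) by auto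
  have bd: "(b, d) \<notin> ?E" using nbr_in_side[OF c(1) _ ds] cb by auto
  have da: "(d, a) \<notin> ?E" using side_closed[OF ds _ d(2) cb(2)] as by auto
  have ad: "a \<noteq> d" using as ds by auto
  have lt: "a < n" "d < n" using edge_V[OF a(1)] edge_V[OF d(1)] by auto
  have cyc: "cycle (complete_graph n) [a, b, d]"
    using cb ad d lt b by (auto simp: cycle_def walk_def complete_graph_def)
  have ce: "cycle_edges [a, b, d] = {{a, b}, {b, d}, {d, a}}"
  proof -
    have "{i. i < length [a, b, d]} = {0, 1, 2}" by auto
    then show ?thesis unfolding cycle_edges_def setcompr_eq_image by (simp add: numeral_2_eq_2)
  qed
  have "{e \<in> cycle_edges [a, b, d]. snd (signed_complete n T) e = - 1} = {{a, b}}"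
    unfolding ce using a(1) bd da edge_sym[OF a(1)] by (auto simp: signed_complete_def adj_def split: if_splits)
  then have "negative_cycle (signed_complete n T) [a, b, d]"
    using cyc by (simp add: negative_cycle_def signed_complete_def)
  then show ?thesis by (auto simp: balanced_def)
qed

text \<open>A cycle through \<open>b\<close> has two edges there, to the cyclic successor and
  predecessor, which differ because the length is at least 3.\<close>

lemma even_cycle_edges_at:
  assumes c: "distinct c" "length c \<ge> 3"
  shows "even (card {e \<in> cycle_edges c. b \<in> e})"
proof (cases "b \<in> set c")
  case False
  have "c ! i \<in> set c" if "i < length c" for i using that by simp
  moreover have "Suc i mod length c < length c" for i using c(2) by (intro mod_less_divisor) linarith
  ultimately have "{e \<in> cycle_edges c. b \<in> e} = {}" using False by (fastforce simp: cycle_edges_def)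
  then show ?thesis by (simp only: card.empty even_zero)
next
  case True
  define m where "m = length c"
  obtain i where i: "i < m" "c ! i = b" using True by (auto simp: in_set_conv_nth m_def)
  define j where "j = (if i = 0 then m - 1 else i - 1)"
  define s where "s = Suc i mod m"
  have m3: "m \<ge> 3" using c(2) by (simp add: m_def)
  have sm: "s < m" "s \<noteq> i" "s \<noteq> j" "j < m" "j \<noteq> i" "Suc j mod m = i"
    using i(1) m3 by (auto simp: s_def j_def mod_Suc)
  have nth: "c ! u = c ! v \<longleftrightarrow> u = v" if "u < m" "v < m" for u v
    using that c(1) by (simp add: nth_eq_iff_index_eq m_def)
  have pred: "t = j" if "t < m" "Suc t mod m = i" for t
    using that i(1) by (auto simp: j_def mod_Suc split: if_splits)
  have "{e \<in> cycle_edges c. b \<in> e} = {{c ! i, c ! s}, {c ! j, c ! i}}"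
  proof
    show "{e \<in> cycle_edges c. b \<in> e} \<subseteq> {{c ! i, c ! s}, {c ! j, c ! i}}"
    proof
      fix e assume "e \<in> {e \<in> cycle_edges c. b \<in> e}"
      then obtain t where t: "t < m" "e = {c ! t, c ! (Suc t mod m)}" "b = c ! t \<or> b = c ! (Suc t mod m)"
        by (auto simp: cycle_edges_def m_def)
      have "Suc t mod m < m" using m3 by (intro mod_less_divisor) linarith
      then have "t = i \<or> Suc t mod m = i" using t(3) nth[OF i(1)] t(1) i(2) by metis
      then show "e \<in> {{c ! i, c ! s}, {c ! j, c ! i}}"
      proof
        assume "t = i"
        then show ?thesis using t(2) by (simp add: s_def)
      next
        assume a: "Suc t mod m = i"
        then show ?thesis using t(2) pred[OF t(1) a] by simp
      qed
    qed
    have "{c ! i, c ! s} \<in> cycle_edges c" "{c ! j, c ! i} \<in> cycle_edges c"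
      using i(1) sm(4,6) unfolding cycle_edges_def m_def[symmetric] s_def by force+
    then show "{{c ! i, c ! s}, {c ! j, c ! i}} \<subseteq> {e \<in> cycle_edges c. b \<in> e}" using i(2) by auto
  qed
  moreover have "{c ! i, c ! s} \<noteq> {c ! j, c ! i}"
    using nth i(1) sm by (auto simp: doubleton_eq_iff)
  ultimately show ?thesis by simp
qed

text \<open>With fewer internal vertices the tree is a star, and the negative edges of a cycle are
  those at its centre, an even number.\<close>

lemma unbalanced_imp_two_internal:
  assumes T: "spanning_tree T (complete_graph n)" and n: "3 \<le> n" and ub: "unbalanced (signed_complete n T)"
  shows "card (pendant_vertices T) + 2 \<le> n"
proof (rule ccontr)
  assume a: "\<not> ?thesis"
  interpret rel_tree "{..<n}" "adj T" by (rule rel_tree_adj[OF T])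
  let ?E = "adj T"
  let ?I = "{..<n} - leaf_set {..<n} ?E"
  have deg1: "card (?E `` {u}) \<ge> 1" if "u < n" for u
  proof -
    define t where "t = (if u = 0 then 1 else 0 :: nat)"
    have "t < n" "t \<noteq> u" using n by (auto simp: t_def)
    then show ?thesis using nbrs_ne[of u t] that by auto
  qed
  have "card ?I = n - card (leaf_set {..<n} ?E)"
    by (subst card_Diff_subset) (auto simp: leaf_set_def)
  then have I1: "card ?I \<le> 1" using a by (simp add: pendant_vertices_adj[OF T])
  have "?I \<noteq> {}"
  proof
    assume "?I = {}"
    then have "card (?E `` {u}) = 1" if "u < n" for u using that by (auto simp: leaf_set_def)
    then have "(\<Sum>u<n. card (?E `` {u})) = n" by simp
    then show False using sum_deg card_E n by simp
  qed
  then obtain b where b: "b \<in> ?I" by blast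
  have leaf: "card (?E `` {u}) = 1" if "u < n" "u \<noteq> b" for u
  proof (rule ccontr)
    assume "card (?E `` {u}) \<noteq> 1"
    then have "{b, u} \<subseteq> ?I" using b that by (auto simp: leaf_set_def)
    then have "card {b, u} \<le> card ?I" by (intro card_mono) auto
    then show False using I1 that(2) by simp
  qed
  have bn: "b < n" using b by simp
  have hub: "u = b \<or> v = b" if e: "(u, v) \<in> ?E" for u v
  proof (rule ccontr)
    assume "\<not> ?thesis"
    then show False
      using leaf_nbr_internal[OF e leaf, of b] leaf[of v] edge_V[OF e] bn by auto
  qed
  have star: "{b, v} \<in> edges T" if v: "v < n" "v \<noteq> b" for v
  proof -
    have "?E `` {v} \<noteq> {}" using deg1[OF v(1)] by auto
    then obtain w where w: "(v, w) \<in> ?E" by auto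
    then have "w = b" using hub v(2) by auto
    then show ?thesis using w by (simp add: adj_def insert_commute)
  qed
  have in_T: "e \<in> edges T \<longleftrightarrow> b \<in> e" if e: "e \<subseteq> {0..<n}" "card e = 2" for e
  proof -
    obtain u v where uv: "e = {u, v}" "u \<noteq> v" using e(2) by (auto simp: card_2_iff)
    have lt: "u < n" "v < n" using e(1) uv by auto
    show ?thesis
    proof
      assume "e \<in> edges T"
      then show "b \<in> e" using hub[of u v] uv by (auto simp: adj_def)
    next
      assume "b \<in> e"
      then show "e \<in> edges T" using star[of u] star[of v] uv lt by (auto simp: insert_commute)
    qed
  qed
  obtain c where c: "cycle (complete_graph n) c" "odd (card {e \<in> cycle_edges c. snd (signed_complete n T) e = - 1})"
    using ub by (auto simp: balanced_def negative_cycle_def signed_complete_def)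
  have cd: "distinct c" "length c \<ge> 3" "set c \<subseteq> {0..<n}"
    using c(1) by (auto simp: cycle_def walk_def complete_graph_def)
  have "e \<subseteq> {0..<n} \<and> card e = 2" if "e \<in> cycle_edges c" for e
  proof -
    obtain i where i: "i < length c" "e = {c ! i, c ! (Suc i mod length c)}"
      using \<open>e \<in> cycle_edges c\<close> by (auto simp: cycle_edges_def)
    have s: "Suc i mod length c < length c" "Suc i mod length c \<noteq> i"
      using i(1) cd(2) by (auto simp: mod_Suc)
    then have "c ! i \<noteq> c ! (Suc i mod length c)" using i(1) cd(1) by (simp add: nth_eq_iff_index_eq)
    moreover have "c ! i \<in> {0..<n}" "c ! (Suc i mod length c) \<in> {0..<n}"
      using nth_mem[OF i(1)] nth_mem[OF s(1)] cd(3) by auto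
    ultimately show ?thesis using i(2) by auto
  qed
  then have "{e \<in> cycle_edges c. snd (signed_complete n T) e = - 1} = {e \<in> cycle_edges c. b \<in> e}"
    using in_T by (auto simp: signed_complete_def)
  then show False using c(2) even_cycle_edges_at[OF cd(1,2)] by simp
qed

text \<open>The entries of J - I - 2 A(T), as a function, which is how the Rayleigh lemmas take a
  matrix.\<close>

definition signed_entry :: "(nat \<times> nat) set \<Rightarrow> nat \<Rightarrow> nat \<Rightarrow> real" where
  "signed_entry E i j = (if i = j then 0 else if (i, j) \<in> E then - 1 else 1)"

lemma adjacency_matrix_signed_complete:
  "adjacency_matrix (signed_complete n T) = mat n n (\<lambda>(i, j). signed_entry (adj T) i j)"
  by (rule eq_matI)
    (auto simp: adjacency_matrix_def signed_complete_def complete_graph_def signed_entry_def adj_def card_insert_if)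

lemma signed_entry_sym: "sym E \<Longrightarrow> signed_entry E i j = signed_entry E j i"
  by (auto simp: signed_entry_def dest: symD)

lemma signed_entry_row:
  assumes "rel_tree {..<n} E" "i < n"
  shows "(\<Sum>j<n. signed_entry E i j * y j) = sum y {..<n} - y i - 2 * sum y (E `` {i})"
proof -
  interpret rel_tree "{..<n}" E by (rule assms(1))
  have "(\<Sum>j<n. signed_entry E i j * y j)
      = (\<Sum>j<n. y j - (if j = i then y j else 0) - 2 * (if j \<in> E `` {i} then y j else 0))"
    using edge_neq[of i i] by (intro sum.cong) (auto simp: signed_entry_def)
  also have "\<dots> = sum y {..<n} - y i - 2 * (\<Sum>j<n. if j \<in> E `` {i} then y j else 0)"
    using assms(2) by (simp add: sum_subtractf sum_distrib_left)
  also have "(\<Sum>j<n. if j \<in> E `` {i} then y j else 0) = sum y (E `` {i})"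
  proof -
    have "{..<n} \<inter> E `` {i} = E `` {i}" using E_sub by auto
    then show ?thesis using sum.inter_restrict[of "{..<n}" y "E `` {i}"] by simp
  qed
  finally show ?thesis .
qed

lemma quad_form_signed_entry:
  assumes "rel_tree {..<n} E"
  shows "quad_form n (signed_entry E) y = (sum y {..<n})\<^sup>2 - (\<Sum>i<n. (y i)\<^sup>2) - 2 * pair_sum E y"
proof -
  interpret rel_tree "{..<n}" E by (rule assms)
  have "quad_form n (signed_entry E) y = (\<Sum>i<n. y i * (\<Sum>j<n. signed_entry E i j * y j))"
    unfolding quad_form_def sum_distrib_left by (intro sum.cong) auto
  also have "\<dots> = (\<Sum>i<n. y i * (sum y {..<n} - y i - 2 * sum y (E `` {i})))"
    by (intro sum.cong refl) (simp add: signed_entry_row[OF assms])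
  also have "\<dots> = (\<Sum>i<n. y i * sum y {..<n} - (y i)\<^sup>2 - 2 * (y i * sum y (E `` {i})))"
    by (intro sum.cong refl) (simp add: algebra_simps power2_eq_square)
  also have "\<dots> = (\<Sum>i<n. y i * sum y {..<n}) - (\<Sum>i<n. (y i)\<^sup>2) - 2 * (\<Sum>i<n. y i * sum y (E `` {i}))"
    by (simp only: sum_subtractf sum_distrib_left)
  finally show ?thesis by (simp only: pair_sum_nbrs sum_distrib_right[symmetric] power2_eq_square)
qed

text \<open>Maximality speaks of unbalanced graphs only, but unbalance of \<open>T\<close> gives
  \<open>k + 2 <= n\<close>, which makes every tree with \<open>k\<close> leaves unbalanced. So one
  Rayleigh bound holds for all of them.\<close>

lemma extremal_nat_treeI:
  fixes n k :: nat and T :: "nat ugraph"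
  assumes n: "6 \<le> n" and T: "spanning_tree T (complete_graph n)"
    and k: "card (pendant_vertices T) = k" and ub: "unbalanced (signed_complete n T)"
    and max: "\<And>T'. spanning_tree T' (complete_graph n) \<Longrightarrow> card (pendant_vertices T') = k \<Longrightarrow>
           unbalanced (signed_complete n T') \<Longrightarrow>
           largest_eigenvalue (adjacency_matrix (signed_complete n T'))
             \<le> largest_eigenvalue (adjacency_matrix (signed_complete n T))"
  obtains x L where "extremal_nat_tree n (adj T) x L"
proof -
  let ?E = "adj T"
  define \<mu> where "\<mu> = largest_eigenvalue (adjacency_matrix (signed_complete n T))"
  have tE: "rel_tree {..<n} ?E" by (rule rel_tree_adj[OF T])
  interpret rel_tree "{..<n}" ?E by (rule tE)
  have n0: "0 < n" using n by simp
  have kE: "card (leaf_set {..<n} ?E) = k" using k pendant_vertices_adj[OF T] by simp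
  have kn: "k + 2 \<le> n" using unbalanced_imp_two_internal[OF T _ ub] n k by simp
  note R = largest_eigenvalue_rayleigh(2)[where a = "signed_entry ?E", OF n0 signed_entry_sym[OF sym_E],
    folded adjacency_matrix_signed_complete \<mu>_def]
  have le: "quad_form n (signed_entry F) y \<le> \<mu> * (\<Sum>i<n. (y i)\<^sup>2)"
    if F: "rel_tree {..<n} F" "card (leaf_set {..<n} F) = k" for F y
  proof -
    interpret F: rel_tree "{..<n}" F by (rule F(1))
    let ?T = "graph_of n F"
    have sT: "spanning_tree ?T (complete_graph n)" by (rule spanning_tree_graph_of[OF F(1)])
    have aT: "adj ?T = F" by (rule adj_graph_of[OF F.sym_E])
    have kT: "card (pendant_vertices ?T) = k" using pendant_vertices_adj[OF sT] aT F(2) by simp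
    have "largest_eigenvalue (adjacency_matrix (signed_complete n ?T)) \<le> \<mu>"
      unfolding \<mu>_def by (rule max[OF sT kT unbalanced_if_two_internal[OF sT]]) (use kT kn in simp)
    moreover have "quad_form n (signed_entry F) y
        \<le> largest_eigenvalue (adjacency_matrix (signed_complete n ?T)) * (\<Sum>i<n. (y i)\<^sup>2)"
      unfolding adjacency_matrix_signed_complete aT
      by (rule largest_eigenvalue_rayleigh(1)[OF n0 signed_entry_sym[OF F.sym_E]])
    ultimately show ?thesis
      by (meson mult_right_mono order.trans sum_nonneg zero_le_power2)
  qed
  obtain z where "(\<exists>i<n. z i \<noteq> 0) \<and> (\<forall>i<n. (\<Sum>j<n. signed_entry ?E i j * z j) = \<mu> * z i)"
    using R by (rule exE)
  then have z: "\<exists>i<n. z i \<noteq> 0" "\<And>i. i < n \<Longrightarrow> (\<Sum>j<n. signed_entry ?E i j * z j) = \<mu> * z i"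
    by simp_all
  \<comment> \<open>The sign of the eigenvector is chosen so that its sum is nonnegative.\<close>
  define x where "x = (if sum z {..<n} \<ge> 0 then z else (\<lambda>i. - z i))"
  have x: "\<exists>i<n. x i \<noteq> 0" "\<And>i. i < n \<Longrightarrow> (\<Sum>j<n. signed_entry ?E i j * x j) = \<mu> * x i" "sum x {..<n} \<ge> 0"
    using z by (auto simp: x_def sum_negf)
  \<comment> \<open>The diagonal is zero, so the form vanishes at a unit vector.\<close>
  have \<mu>0: "\<mu> \<ge> 0"
  proof -
    define e where "e i = (if i = 0 then 1 else 0 :: real)" for i :: nat
    have "signed_entry ?E i j * e i * e j = 0" for i j by (simp add: e_def signed_entry_def)
    then have "quad_form n (signed_entry ?E) e = 0" by (simp add: quad_form_def)
    moreover have "(\<Sum>i<n. (e i)\<^sup>2) = 1"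
      using n0 by (simp add: e_def if_distrib[of "\<lambda>t. t\<^sup>2"] cong: if_cong)
    ultimately show ?thesis using le[OF tE kE, of e] by simp
  qed
  have "extremal_nat_tree n ?E x (\<mu> + 1)"
  proof unfold_locales
    show "0 < \<mu> + 1" using \<mu>0 by simp
    show "(\<mu> + 1) * x v = sum x {..<n} - 2 * sum x (?E `` {v})" if "v \<in> {..<n}" for v
      using x(2)[of v] signed_entry_row[OF tE, of v x] that by (simp add: algebra_simps)
    show "\<exists>v\<in>{..<n}. x v \<noteq> 0" using x(1) by auto
    show "0 \<le> sum x {..<n}" by (rule x(3))
    fix F assume F: "rel_tree {..<n} F" "card (leaf_set {..<n} F) = card (leaf_set {..<n} ?E)"
    note F' = F(1) F(2)[unfolded kE]
    show "(sum y {..<n})\<^sup>2 - 2 * pair_sum F y \<le> (\<mu> + 1) * (\<Sum>v<n. (y v)\<^sup>2)" for y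
      using le[OF F', of y] by (simp add: quad_form_signed_entry[OF F(1)] algebra_simps)
    show "(\<mu> + 1) * x v = sum x {..<n} - 2 * sum x (F `` {v})"
      if q: "(sum x {..<n})\<^sup>2 - 2 * pair_sum F x = (\<mu> + 1) * (\<Sum>v<n. (x v)\<^sup>2)" and v: "v \<in> {..<n}" for v
    proof -
      interpret F: rel_tree "{..<n}" F by (rule F(1))
      \<comment> \<open>The bound \<open>\<mu>\<close> of the extremal tree also holds for
        \<open>F\<close>, and \<open>x\<close> attains it there.\<close>
      have "(\<Sum>j<n. signed_entry F v j * x j) = \<mu> * x v"
        by (rule rayleigh_equality[OF signed_entry_sym[OF F.sym_E] le[OF F']])
          (use q v in \<open>auto simp: quad_form_signed_entry[OF F(1)] algebra_simps\<close>)
      then show ?thesis using signed_entry_row[OF F(1), of v x] v by (simp add: algebra_simps)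
    qed
  qed
  then show thesis by (rule that)
qed

lemma adj_T_star:
  assumes "1 \<le> k" "k < n"
  shows "adj (T_star n k) = broom n k"
proof -
  have "{u, v} \<in> edges (T_star n k) \<longleftrightarrow> (u, v) \<in> broom n k" for u v
  proof
    assume "{u, v} \<in> edges (T_star n k)"
    then consider i where "{u, v} = {0, i}" "1 \<le> i" "i \<le> k"
      | i where "{u, v} = {i, Suc i}" "k \<le> i" "Suc i < n"
      by (auto simp: T_star_def star_graph_def path_graph_def)
    then show "(u, v) \<in> broom n k"
      using assms by cases (auto simp: broom_iff broom_parent_def doubleton_eq_iff)
  next
    have e: "{i, broom_parent k i} \<in> edges (T_star n k)" if i: "1 \<le> i" "i < n" for i
    proof (cases "i \<le> k")
      case True
      then show ?thesis using i by (auto simp: T_star_def star_graph_def broom_parent_def insert_commute)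
    next
      case False
      then have "{i, broom_parent k i} = {i - 1, Suc (i - 1)}" "k \<le> i - 1" "Suc (i - 1) < n"
        using i by (auto simp: broom_parent_def)
      then show ?thesis unfolding T_star_def path_graph_def by auto
    qed
    assume "(u, v) \<in> broom n k"
    then show "{u, v} \<in> edges (T_star n k)"
      using e[of u] e[of v] by (auto simp: broom_iff insert_commute)
  qed
  then show ?thesis by (auto simp: adj_def)
qed

theorem theorem1p1:
  fixes n k :: nat and T :: "nat ugraph"
  assumes "n \<ge> 6"
    and "spanning_tree T (complete_graph n)"
    and "card (pendant_vertices T) = k"
    and "unbalanced (signed_complete n T)"
    and "\<And>T'. spanning_tree T' (complete_graph n) \<Longrightarrow> card (pendant_vertices T') = k \<Longrightarrow>
           unbalanced (signed_complete n T') \<Longrightarrow>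
           largest_eigenvalue (adjacency_matrix (signed_complete n T'))
             \<le> largest_eigenvalue (adjacency_matrix (signed_complete n T))"
  shows "graph_iso T (T_star n k)"
proof -
  obtain x L where "extremal_nat_tree n (adj T) x L" using extremal_nat_treeI[OF assms] .
  then interpret extremal_nat_tree n "adj T" x L .
  have lk: "card (leaf_set {..<n} (adj T)) = k" using assms(3) pendant_vertices_adj[OF assms(2)] by simp
  have kn: "k + 2 \<le> n" using unbalanced_imp_two_internal[OF assms(2) _ assms(4)] assms(1,3) by simp
  have k2: "2 \<le> k" using card_leaf_set lk assms(1) by simp
  obtain b c where bc: "b < n" "card (adj T `` {b}) = k"
    "\<And>u. u < n \<Longrightarrow> u \<noteq> b \<Longrightarrow> card (adj T `` {u}) \<le> 2"
    "\<And>u. (b, u) \<in> adj T \<Longrightarrow> u \<noteq> c \<Longrightarrow> card (adj T `` {u}) = 1"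
    by (rule extremal_structure[OF assms(1) kn[folded lk], unfolded lk]) blast
  obtain f where f: "bij_betw f {..<n} {..<n}"
    "\<And>u v. u < n \<Longrightarrow> v < n \<Longrightarrow> (u, v) \<in> adj T \<longleftrightarrow> (f u, f v) \<in> broom n k"
    using broom_shape[of b k c] bc kn by auto
  have vT: "verts T = {..<n}" using assms(2) by (auto simp: spanning_tree_def complete_graph_def)
  have vS: "verts (T_star n k) = {..<n}"
    using kn by (auto simp: T_star_def star_graph_def path_graph_def)
  have "{u, v} \<in> edges T \<longleftrightarrow> {f u, f v} \<in> edges (T_star n k)" if "u < n" "v < n" for u v
  proof -
    have "(f u, f v) \<in> adj (T_star n k) \<longleftrightarrow> (u, v) \<in> adj T"
      using f(2)[OF that] adj_T_star[of k n] k2 kn by simp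
    then show ?thesis by (simp add: adj_def)
  qed
  then show ?thesis unfolding graph_iso_def vT vS using f(1) by auto
qed

end
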